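(* Let $A=KQ/I$ be an almost gentle algebra, let $A^*=KQ^*/I^*$ be the symmetric special multiserial algebra associated to $A$, and let $T(A)=A\rtimes D(A)$ be the trivial extension of $A$ by $D(A)=\operatorname{Hom}_K(A,K)$. Then $A^*$ is isomorphic to $T(A)$.
   Context: $K$ is a field; all algebras are indecomposable and finite dimensional over $K$. Quivers are finite, $Q_0$ is the set of vertices and $Q_1$ the set of arrows of $Q$; $ab$ denotes the arrow $a$ followed by the arrow $b$ (and is $0$ in $KQ$ if not composable). For a presentation $KQ/I$ the ideal $I$ is admissible. An algebra is almost gentle if it is Morita equivalent to some $KQ/I$ such that (S0) $I$ is generated by paths of length 2, and (S1) for every $a\in Q_1$ there is at most one arrow $b$ with $ab\notin I$ and at most one arrow $c$ with $ca\notin I$. "Let $A=KQ/I$ be almost gentle" means that the presentation satisfies (S0) and (S1). A path $p$ in $Q$ is a maximal path of $A$ if $p\notin I$ and $ap\in I$ and $pa\in I$ for every arrow $a\in Q_1$. $\mathcal M$ is the set of maximal paths of $A$. Definition of $A^*$: the quiver $Q^*$ has the same vertices as $Q$, and its arrows are those of $Q$ together with, for each $m\in\mathcal M$, a new arrow $a_m$ from the end vertex of $m$ to the start vertex of $m$. Put $C_m=ma_m$, a cycle in $Q^*$, and let $\mathcal S$ be the set of all cyclic permutations of the cycles $C_m$, $m\in\mathcal M$. The ideal $I^*$ of $KQ^*$ is generated by: Type 1: $C-C'$ for $C,C'\in\mathcal S$ cycles at the same vertex; Type 2: $Ca$ for $C\in\mathcal S$ with first arrow $a$; Type 3: $ab$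 for arrows $a,b$ of $Q^*$ such that $ab$ is not a subpath of any $C\in\mathcal S$. Then $A^*=KQ^*/I^*$. The trivial extension $T(A)$ is the vector space $A\oplus D(A)$ with multiplication $(a,f)(b,g)=(ab,ag+fb)$, where the $A$-$A$-bimodule structure on $D(A)$ is $(afb)(x)=f(bxa)$. *)

theory Defs
  imports "HOL-Algebra.Module" "HOL-Algebra.QuotRing" "HOL-Algebra.Ideal_Product"
    "HOL-Library.Sublist" "Graph_Theory.Arc_Walk"
begin

section \<open>Algebras over a field\<close>

text \<open>
  The ground field is a type \<open>'k\<close> of class \<open>field\<close>. A \<open>K\<close>-algebra is a record of type
  \<open>('k, 'x) module\<close>, i.e. a ring together with a scalar multiplication; the locale \<open>algebra\<close>
  of HOL-Algebra is not used because it forces the ring to be commutative.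
\<close>

definition alg_iso :: "('k::field, 'x) module \<Rightarrow> ('k, 'y) module \<Rightarrow> ('x \<Rightarrow> 'y) set" where
  "alg_iso A B =
     {h \<in> ring_iso A B. \<forall>c. \<forall>x\<in>carrier A. h (c \<odot>\<^bsub>A\<^esub> x) = c \<odot>\<^bsub>B\<^esub> h x}"

definition alg_isomorphic :: "('k::field, 'x) module \<Rightarrow> ('k, 'y) module \<Rightarrow> bool" where
  "alg_isomorphic A B \<longleftrightarrow> alg_iso A B \<noteq> {}"

text \<open>The scalar multiplication follows the pattern of \<^const>\<open>rcoset_mult\<close>.\<close>

definition quot_algebra :: "('k::field, 'x) module \<Rightarrow> 'x set \<Rightarrow> ('k, 'x set) module" where
  "quot_algebra A I =
     \<lparr>carrier = carrier (A Quot I), mult = mult (A Quot I), one = one (A Quot I),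
      zero = zero (A Quot I), add = add (A Quot I),
      smult = (\<lambda>c X. \<Union>x\<in>X. I +>\<^bsub>A\<^esub> (c \<odot>\<^bsub>A\<^esub> x))\<rparr>"

text \<open>Nonzero, and not a direct product of two nonzero algebras.\<close>

definition indecomposable_algebra :: "('k::field, 'x) module \<Rightarrow> bool" where
  "indecomposable_algebra A \<longleftrightarrow>
     carrier A \<noteq> {\<zero>\<^bsub>A\<^esub>} \<and>
     \<not> (\<exists>I J. ideal I A \<and> ideal J A \<and> I \<noteq> {\<zero>\<^bsub>A\<^esub>} \<and> J \<noteq> {\<zero>\<^bsub>A\<^esub>} \<and>
            I \<inter> J = {\<zero>\<^bsub>A\<^esub>} \<and> I <+>\<^bsub>A\<^esub> J = carrier A)"

text \<open>
  \<open>D(A) = Hom\<^sub>K(A, K)\<close>; functionals are \<^const>\<open>undefined\<close> outside the carrier, so that equality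
  of functions is equality of functionals.
\<close>

definition dual_space :: "('k::field, 'x) module \<Rightarrow> ('x \<Rightarrow> 'k) set" where
  "dual_space A =
     {f \<in> extensional (carrier A).
        (\<forall>x\<in>carrier A. \<forall>y\<in>carrier A. f (x \<oplus>\<^bsub>A\<^esub> y) = f x + f y) \<and>
        (\<forall>c. \<forall>x\<in>carrier A. f (c \<odot>\<^bsub>A\<^esub> x) = c * f x)}"

text \<open>The bimodule structure: \<open>dual_act A a f b\<close> is the functional \<open>afb\<close>.\<close>

definition dual_act ::
    "('k::field, 'x) module \<Rightarrow> 'x \<Rightarrow> ('x \<Rightarrow> 'k) \<Rightarrow> 'x \<Rightarrow> ('x \<Rightarrow> 'k)" where
  "dual_act A a f b = (\<lambda>x\<in>carrier A. f (b \<otimes>\<^bsub>A\<^esub> x \<otimes>\<^bsub>A\<^esub> a))"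

definition dual_add ::
    "('k::field, 'x) module \<Rightarrow> ('x \<Rightarrow> 'k) \<Rightarrow> ('x \<Rightarrow> 'k) \<Rightarrow> ('x \<Rightarrow> 'k)" where
  "dual_add A f g = (\<lambda>x\<in>carrier A. f x + g x)"

definition trivial_extension :: "('k::field, 'x) module \<Rightarrow> ('k, 'x \<times> ('x \<Rightarrow> 'k)) module" where
  "trivial_extension A =
     \<lparr>carrier = carrier A \<times> dual_space A,
      mult = (\<lambda>(a, f) (b, g).
        (a \<otimes>\<^bsub>A\<^esub> b, dual_add A (dual_act A a g \<one>\<^bsub>A\<^esub>) (dual_act A \<one>\<^bsub>A\<^esub> f b))),
      one = (\<one>\<^bsub>A\<^esub>, \<lambda>x\<in>carrier A. 0),
      zero = (\<zero>\<^bsub>A\<^esub>, \<lambda>x\<in>carrier A. 0),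
      add = (\<lambda>(a, f) (b, g). (a \<oplus>\<^bsub>A\<^esub> b, dual_add A f g)),
      smult = (\<lambda>c (a, f). (c \<odot>\<^bsub>A\<^esub> a, \<lambda>x\<in>carrier A. c * f x))\<rparr>"


section \<open>Path algebras\<close>

text \<open>
  A quiver is a multi-digraph (loops and parallel arrows allowed). A path is a pair of its start
  vertex and its list of arrows in the order in which they are traversed; \<open>(v, [])\<close> is the
  trivial path at \<open>v\<close>.
\<close>

type_synonym ('v, 'a) qpath = "'v \<times> 'a list"

definition path_end :: "('v, 'a) pre_digraph \<Rightarrow> ('v, 'a) qpath \<Rightarrow> 'v" where
  "path_end Q p = pre_digraph.awlast Q (fst p) (snd p)"

definition paths :: "('v, 'a) pre_digraph \<Rightarrow> ('v, 'a) qpath set" where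
  "paths Q = {p. pre_digraph.awalk Q (fst p) (snd p) (path_end Q p)}"

text \<open>
  Elements of \<open>KQ\<close> are the finitely supported functions on paths. The coefficient of a path in a
  product is the sum over all ways of cutting the path in two.
\<close>

definition path_algebra ::
    "('v, 'a) pre_digraph \<Rightarrow> ('k::field, ('v, 'a) qpath \<Rightarrow> 'k) module" where
  "path_algebra Q =
     \<lparr>carrier = {f. finite {p. f p \<noteq> 0} \<and> {p. f p \<noteq> 0} \<subseteq> paths Q},
      mult = (\<lambda>f g (u, p).
        \<Sum>i\<le>length p. f (u, take i p) * g (path_end Q (u, take i p), drop i p)),
      one = (\<lambda>p. if fst p \<in> verts Q \<and> snd p = [] then 1 else 0),
      zero = (\<lambda>p. 0),
      add = (\<lambda>f g p. f p + g p),
      smult = (\<lambda>c f p. c * f p)\<rparr>"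

definition of_path :: "('v, 'a) qpath \<Rightarrow> (('v, 'a) qpath \<Rightarrow> 'k::field)" where
  "of_path p = (\<lambda>q. if q = p then 1 else 0)"

definition of_arrow :: "('v, 'a) pre_digraph \<Rightarrow> 'a \<Rightarrow> (('v, 'a) qpath \<Rightarrow> 'k::field)" where
  "of_arrow Q a = of_path (tail Q a, [a])"

definition arrow_ideal :: "('v, 'a) pre_digraph \<Rightarrow> (('v, 'a) qpath \<Rightarrow> 'k::field) set" where
  "arrow_ideal Q = Idl\<^bsub>path_algebra Q\<^esub> (of_arrow Q ` arcs Q)"

text \<open>Powers of ideals are taken in the monoid \<^const>\<open>ideals_set\<close> of ideals.\<close>

definition admissible ::
    "('v, 'a) pre_digraph \<Rightarrow> (('v, 'a) qpath \<Rightarrow> 'k::field) set \<Rightarrow> bool" where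
  "admissible Q I \<longleftrightarrow>
     ideal I (path_algebra Q) \<and>
     I \<subseteq> arrow_ideal Q [^]\<^bsub>ideals_set (path_algebra Q)\<^esub> (2::nat) \<and>
     (\<exists>N\<ge>2. arrow_ideal Q [^]\<^bsub>ideals_set (path_algebra Q)\<^esub> (N::nat) \<subseteq> I)"


section \<open>Almost gentle algebras\<close>

text \<open>
  The first conjunct is (S0), the second one is (S1). The products in (S1) are taken in \<open>KQ\<close>, so
  they are zero, hence in \<open>I\<close>, for arrows that are not composable.
\<close>

definition almost_gentle ::
    "('v, 'a) pre_digraph \<Rightarrow> (('v, 'a) qpath \<Rightarrow> 'k::field) set \<Rightarrow> bool" where
  "almost_gentle Q I \<longleftrightarrow>
     (\<exists>P \<subseteq> {p \<in> paths Q. length (snd p) = 2}. I = Idl\<^bsub>path_algebra Q\<^esub> (of_path ` P)) \<and>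
     (\<forall>a\<in>arcs Q.
        (\<exists>\<^sub>\<le>\<^sub>1b. b \<in> arcs Q \<and> of_arrow Q a \<otimes>\<^bsub>path_algebra Q\<^esub> of_arrow Q b \<notin> I) \<and>
        (\<exists>\<^sub>\<le>\<^sub>1c. c \<in> arcs Q \<and> of_arrow Q c \<otimes>\<^bsub>path_algebra Q\<^esub> of_arrow Q a \<notin> I))"

definition maximal_paths ::
    "('v, 'a) pre_digraph \<Rightarrow> (('v, 'a) qpath \<Rightarrow> 'k::field) set \<Rightarrow> ('v, 'a) qpath set" where
  "maximal_paths Q I =
     {p \<in> paths Q. of_path p \<notin> I \<and>
        (\<forall>a\<in>arcs Q. of_arrow Q a \<otimes>\<^bsub>path_algebra Q\<^esub> of_path p \<in> I \<and>
                    of_path p \<otimes>\<^bsub>path_algebra Q\<^esub> of_arrow Q a \<in> I)}"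


section \<open>The algebra \<open>A\<^sup>*\<close>\<close>

text \<open>The arrow \<open>a\<close> of \<open>Q\<close> becomes \<open>Inl a\<close>, and \<open>Inr m\<close> is the new arrow \<open>a\<^sub>m\<close>.\<close>

definition star_quiver ::
    "('v, 'a) pre_digraph \<Rightarrow> (('v, 'a) qpath \<Rightarrow> 'k::field) set \<Rightarrow>
     ('v, 'a + ('v, 'a) qpath) pre_digraph" where
  "star_quiver Q I =
     \<lparr>verts = verts Q,
      arcs = Inl ` arcs Q \<union> Inr ` maximal_paths Q I,
      tail = case_sum (tail Q) (path_end Q),
      head = case_sum (head Q) fst\<rparr>"

definition max_cycle :: "('v, 'a) qpath \<Rightarrow> ('a + ('v, 'a) qpath) list" where
  "max_cycle m = map Inl (snd m) @ [Inr m]"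

text \<open>The set \<open>\<S>\<close> of all cyclic permutations of the cycles \<open>C\<^sub>m\<close>.\<close>

definition cycles ::
    "('v, 'a) pre_digraph \<Rightarrow> (('v, 'a) qpath \<Rightarrow> 'k::field) set \<Rightarrow>
     ('v, 'a + ('v, 'a) qpath) qpath set" where
  "cycles Q I =
     {(tail (star_quiver Q I) (hd w), w) |w.
        \<exists>m\<in>maximal_paths Q I. \<exists>i. w = rotate i (max_cycle m)}"

definition type1_relations ::
    "('v, 'a) pre_digraph \<Rightarrow> (('v, 'a) qpath \<Rightarrow> 'k::field) set \<Rightarrow>
     (('v, 'a + ('v, 'a) qpath) qpath \<Rightarrow> 'k) set" where
  "type1_relations Q I =
     {of_path C \<ominus>\<^bsub>path_algebra (star_quiver Q I)\<^esub> of_path C' |C C'.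
        C \<in> cycles Q I \<and> C' \<in> cycles Q I \<and> fst C = fst C'}"

definition type2_relations ::
    "('v, 'a) pre_digraph \<Rightarrow> (('v, 'a) qpath \<Rightarrow> 'k::field) set \<Rightarrow>
     (('v, 'a + ('v, 'a) qpath) qpath \<Rightarrow> 'k) set" where
  "type2_relations Q I =
     {of_path C \<otimes>\<^bsub>path_algebra (star_quiver Q I)\<^esub> of_arrow (star_quiver Q I) (hd (snd C)) |C.
        C \<in> cycles Q I}"

definition type3_relations ::
    "('v, 'a) pre_digraph \<Rightarrow> (('v, 'a) qpath \<Rightarrow> 'k::field) set \<Rightarrow>
     (('v, 'a + ('v, 'a) qpath) qpath \<Rightarrow> 'k) set" where
  "type3_relations Q I =
     {of_arrow (star_quiver Q I) a \<otimes>\<^bsub>path_algebra (star_quiver Q I)\<^esub>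
        of_arrow (star_quiver Q I) b |a b.
        a \<in> arcs (star_quiver Q I) \<and> b \<in> arcs (star_quiver Q I) \<and>
        \<not> (\<exists>C\<in>cycles Q I. sublist [a, b] (snd C))}"

definition star_ideal ::
    "('v, 'a) pre_digraph \<Rightarrow> (('v, 'a) qpath \<Rightarrow> 'k::field) set \<Rightarrow>
     (('v, 'a + ('v, 'a) qpath) qpath \<Rightarrow> 'k) set" where
  "star_ideal Q I =
     Idl\<^bsub>path_algebra (star_quiver Q I)\<^esub>
       (type1_relations Q I \<union> type2_relations Q I \<union> type3_relations Q I)"

definition star_algebra ::
    "('v, 'a) pre_digraph \<Rightarrow> (('v, 'a) qpath \<Rightarrow> 'k::field) set \<Rightarrow>
     ('k, (('v, 'a + ('v, 'a) qpath) qpath \<Rightarrow> 'k) set) module" where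
  "star_algebra Q I = quot_algebra (path_algebra (star_quiver Q I)) (star_ideal Q I)"

end

(*
  Let S be the set of cyclic permutations of the cycles C_m. By (S1) every arrow of Q* is the first
  arrow of exactly one element of S, and each element of S contains exactly one new arrow. Since S
  is closed under rotation, t(F) = sum of the coefficients F(C), C in S, is a trace on KQ*.
  Restricting F to the old paths and sending x in KQ to t(xF) defines an algebra homomorphism
  KQ* -> A + D(A) = T(A); multiplicativity holds because a product of two factors with new arrows
  has trace zero. It is onto: the functional dual to a nonzero path p of A is the image of a path w
  with pw in S. Its kernel is I*: modulo I* every path of Q* vanishes or is trivial or an initial
  segment of an element of S, and the coefficients of these can be read off from the image.
*)

theory Submission
  imports Defs
begin

section \<open>Path algebras\<close>

text \<open>The uniqueness behind the cycles has two sources. By (S0) the ideal \<open>I\<close> is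
  spanned by paths, and a path lies in it only through two consecutive arrows. By (S1) having a
  nonzero product is a relation between arrows that is functional in both directions, so a nonzero
  path with at least one arrow can be prolonged in at most one way at each end; admissibility bounds
  its length. Hence an old arrow occurs in exactly one maximal path, at exactly one place.

  The ideal \<open>star_ideal\<close> is known only through generators, and the delicate inclusion
  is that of the kernel in it. Paths without new arrows are seen by the first component. A proper
  initial segment \<open>w\<close> of a cycle that contains the new arrow is seen through a single
  value of the functional, at the nontrivial path that completes \<open>w\<close> to the cycle. A
  full cycle has only a trivial complement, and evaluation at that vertex yields the sum of the
  coefficients of all cycles there. The individual coefficients of cycles thus stay invisible, and
  exactly this loss is accounted for by Type 1.\<close>

lemma path_end_Nil [simp]: "path_end Q (u, []) = u"
  by (simp add: path_end_def pre_digraph.awalk_verts.simps)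

lemma path_end_Cons [simp]: "path_end Q (u, e # es) = path_end Q (head Q e, es)"
  by (simp add: path_end_def pre_digraph.awalk_verts.simps pre_digraph.awalk_verts_non_Nil)

lemma path_end_append: "path_end Q (u, p @ q) = path_end Q (path_end Q (u, p), q)"
  by (induction p arbitrary: u) simp_all

lemma path_end_snoc [simp]: "path_end Q (u, p @ [e]) = head Q e"
  by (simp add: path_end_append)

lemma path_end_take_drop:
  "path_end Q (path_end Q (u, take i p), drop i p) = path_end Q (u, p)"
  by (simp flip: path_end_append)

lemma path_algebra_simps:
  "carrier (path_algebra Q) = {f. finite {p. f p \<noteq> 0} \<and> {p. f p \<noteq> 0} \<subseteq> paths Q}"
  "\<one>\<^bsub>path_algebra Q\<^esub> = (\<lambda>p. if fst p \<in> verts Q \<and> snd p = [] then 1 else 0)"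
  "\<zero>\<^bsub>path_algebra Q\<^esub> = (\<lambda>p. 0)"
  "f \<oplus>\<^bsub>path_algebra Q\<^esub> g = (\<lambda>p. f p + g p)"
  "c \<odot>\<^bsub>path_algebra Q\<^esub> f = (\<lambda>p. c * f p)"
  by (simp_all add: path_algebra_def)

lemma path_mult:
  "(f \<otimes>\<^bsub>path_algebra Q\<^esub> g) (u, p) =
     (\<Sum>i\<le>length p. f (u, take i p) * g (path_end Q (u, take i p), drop i p))"
  by (simp add: path_algebra_def)

lemma path_mult_nonzeroE:
  assumes "(f \<otimes>\<^bsub>path_algebra Q\<^esub> g) (u, w) \<noteq> 0"
  obtains i where "f (u, take i w) \<noteq> 0" "g (path_end Q (u, take i w), drop i w) \<noteq> 0"
proof (rule ccontr)
  assume "\<not> thesis"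
  with that have "\<forall>i. f (u, take i w) * g (path_end Q (u, take i w), drop i w) = 0"
    by auto
  with assms show False
    by (simp add: path_mult)
qed

lemma prefix_take: "prefix xs ys \<longleftrightarrow> take (length xs) ys = xs"
  by (metis append_eq_conv_conj prefix_def)

text \<open>Among all cuts of \<open>w\<close> only the one at the length of \<open>p\<close> can
  contribute.\<close>

lemma path_mult_of_path_left:
  "(of_path p \<otimes>\<^bsub>path_algebra Q\<^esub> g) (u, w) =
     (if u = fst p \<and> prefix (snd p) w then g (path_end Q p, drop (length (snd p)) w) else 0)"
proof -
  have "(of_path p \<otimes>\<^bsub>path_algebra Q\<^esub> g) (u, w) =
      (\<Sum>i\<le>length w. if i = length (snd p)
         then (if u = fst p \<and> prefix (snd p) w then g (path_end Q p, drop (length (snd p)) w) else 0)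
         else 0)"
    unfolding path_mult
    by (rule sum.cong) (auto simp: of_path_def prefix_take)
  then show ?thesis
    by (auto simp: prefix_length_le)
qed

text \<open>The surviving cut is counted from the end. Truncated subtraction is harmless, since the
  existence of \<open>p\<close> forces \<open>snd q\<close> to fit into \<open>w\<close>.\<close>

lemma path_mult_of_path_right:
  "(g \<otimes>\<^bsub>path_algebra Q\<^esub> of_path q) (u, w) =
     (if \<exists>p. w = p @ snd q \<and> path_end Q (u, p) = fst q
      then g (u, take (length w - length (snd q)) w) else 0)"
proof -
  let ?i = "length w - length (snd q)"
  have *: "\<exists>p. w = p @ snd q" if "drop i w = snd q" for i
    using that by (metis append_take_drop_id)
  have "(g \<otimes>\<^bsub>path_algebra Q\<^esub> of_path q) (u, w) =
      (\<Sum>i\<le>length w. if i = ?i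
         then (if \<exists>p. w = p @ snd q \<and> path_end Q (u, p) = fst q
      then g (u, take (length w - length (snd q)) w) else 0)
         else 0)"
    unfolding path_mult
  proof (rule sum.cong)
    fix i assume "i \<in> {..length w}"
    then have i: "i \<le> length w" by simp
    show "g (u, take i w) * of_path q (path_end Q (u, take i w), drop i w) =
        (if i = ?i then if \<exists>p. w = p @ snd q \<and> path_end Q (u, p) = fst q
           then g (u, take ?i w) else 0 else 0)"
    proof (cases "drop i w = snd q")
      case True
      then have "w = take i w @ snd q" by (metis append_take_drop_id)
      moreover have "i = ?i" using i by (simp flip: True)
      ultimately have "(\<exists>p. w = p @ snd q \<and> path_end Q (u, p) = fst q) \<longleftrightarrow> path_end Q (u, take i w) = fst q"
        by (metis append_same_eq)
      then show ?thesis using True \<open>i = ?i\<close>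
        by (auto simp: of_path_def prod_eq_iff)
    next
      case False
      then have "\<not> (i = ?i \<and> (\<exists>p. w = p @ snd q \<and> path_end Q (u, p) = fst q))"
        using i by auto
      then show ?thesis using False by (auto simp: of_path_def prod_eq_iff)
    qed
  qed simp
  then show ?thesis by auto
qed

lemma of_path_mult:
  "of_path p \<otimes>\<^bsub>path_algebra Q\<^esub> of_path q =
     (if path_end Q p = fst q then of_path (fst p, snd p @ snd q) else (\<lambda>_. 0))"
proof (rule ext, clarify)
  fix u w
  show "(of_path p \<otimes>\<^bsub>path_algebra Q\<^esub> of_path q) (u, w) =
     (if path_end Q p = fst q then of_path (fst p, snd p @ snd q) else (\<lambda>_. 0)) (u, w)"
    unfolding path_mult_of_path_left
    by (cases p; cases q) (auto simp: of_path_def prefix_def)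
qed

text \<open>Both sides sum over the cuts of a path into three pieces; the left side is reindexed
  over a triangle so that the first cut becomes the outer index. Every coefficient is a finite sum,
  so the law is stated for arbitrary functions and later rewrites carry no side conditions.\<close>

lemma path_mult_assoc:
  fixes f g h :: "'a \<times> 'b list \<Rightarrow> 'k::field"
  shows "(f \<otimes>\<^bsub>path_algebra Q\<^esub> g) \<otimes>\<^bsub>path_algebra Q\<^esub> h =
     f \<otimes>\<^bsub>path_algebra Q\<^esub> (g \<otimes>\<^bsub>path_algebra Q\<^esub> h)"
proof (rule ext, clarify)
  fix u :: 'a and p :: "'b list"
  let ?n = "length p" and ?E = "\<lambda>w. path_end Q (u, w)"
  let ?F = "\<lambda>j i. f (u, take j p) * g (?E (take j p), take i (drop j p)) *
              h (?E (take (j + i) p), drop (j + i) p)"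
  have E: "path_end Q (?E (take j p), take i (drop j p)) = ?E (take (j + i) p)" for i j
    by (simp add: take_add path_end_append)
  have "((f \<otimes>\<^bsub>path_algebra Q\<^esub> g) \<otimes>\<^bsub>path_algebra Q\<^esub> h) (u, p) = (\<Sum>k\<le>?n. \<Sum>i\<le>k. ?F i (k - i))"
    unfolding path_mult
    by (auto simp: sum_distrib_right drop_take min_def intro!: sum.cong)
  also have "\<dots> = sum (\<lambda>(i, j). ?F i j) {(i, j). i + j \<le> ?n}"
    by (rule sum.triangle_reindex_eq [symmetric])
  also have "{(i, j). i + j \<le> ?n} = Sigma {..?n} (\<lambda>i. {..?n - i})"
    by auto
  also have "sum (\<lambda>(i, j). ?F i j) (Sigma {..?n} (\<lambda>i. {..?n - i})) = (\<Sum>i\<le>?n. \<Sum>j\<le>?n - i. ?F i j)"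
    by (subst sum.Sigma) auto
  also have "\<dots> = (f \<otimes>\<^bsub>path_algebra Q\<^esub> (g \<otimes>\<^bsub>path_algebra Q\<^esub> h)) (u, p)"
    unfolding path_mult
    by (auto simp: sum_distrib_left mult.assoc E add.commute intro!: sum.cong)
  finally show "((f \<otimes>\<^bsub>path_algebra Q\<^esub> g) \<otimes>\<^bsub>path_algebra Q\<^esub> h) (u, p) = (f \<otimes>\<^bsub>path_algebra Q\<^esub> (g \<otimes>\<^bsub>path_algebra Q\<^esub> h)) (u, p)" .
qed

lemma path_mult_add_left:
  "(f \<oplus>\<^bsub>path_algebra Q\<^esub> g) \<otimes>\<^bsub>path_algebra Q\<^esub> h =
     f \<otimes>\<^bsub>path_algebra Q\<^esub> h \<oplus>\<^bsub>path_algebra Q\<^esub> g \<otimes>\<^bsub>path_algebra Q\<^esub> h"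
  by (rule ext, clarify) (simp add: path_mult path_algebra_simps(4) distrib_right sum.distrib)

lemma path_mult_add_right:
  "h \<otimes>\<^bsub>path_algebra Q\<^esub> (f \<oplus>\<^bsub>path_algebra Q\<^esub> g) =
     h \<otimes>\<^bsub>path_algebra Q\<^esub> f \<oplus>\<^bsub>path_algebra Q\<^esub> h \<otimes>\<^bsub>path_algebra Q\<^esub> g"
  by (rule ext, clarify) (simp add: path_mult path_algebra_simps(4) distrib_left sum.distrib)

lemma path_mult_smult_left:
  "(c \<odot>\<^bsub>path_algebra Q\<^esub> f) \<otimes>\<^bsub>path_algebra Q\<^esub> g = c \<odot>\<^bsub>path_algebra Q\<^esub> (f \<otimes>\<^bsub>path_algebra Q\<^esub> g)"
  by (rule ext, clarify) (simp add: path_mult path_algebra_simps(5) sum_distrib_left mult.assoc)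

lemma path_mult_smult_right:
  "f \<otimes>\<^bsub>path_algebra Q\<^esub> (c \<odot>\<^bsub>path_algebra Q\<^esub> g) = c \<odot>\<^bsub>path_algebra Q\<^esub> (f \<otimes>\<^bsub>path_algebra Q\<^esub> g)"
  by (rule ext, clarify) (simp add: path_mult path_algebra_simps(5) sum_distrib_left mult.left_commute)

section \<open>Paths, supports and induction over supports\<close>

context wf_digraph
begin

lemma paths_Nil [simp]: "(u, []) \<in> paths G \<longleftrightarrow> u \<in> verts G"
  by (simp add: paths_def awalk_Nil_iff)

lemma paths_Cons [simp]:
  "(u, e # es) \<in> paths G \<longleftrightarrow> e \<in> arcs G \<and> u = tail G e \<and> (head G e, es) \<in> paths G"
  by (auto simp: paths_def awalk_Cons_iff)

lemma paths_append:
  "(u, p @ q) \<in> paths G \<longleftrightarrow> (u, p) \<in> paths G \<and> (path_end G (u, p), q) \<in> paths G"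
proof (induction p arbitrary: u)
  case Nil
  then show ?case
    by (cases q) auto
qed auto

lemma paths_arcs: "(u, p) \<in> paths G \<Longrightarrow> set p \<subseteq> arcs G"
  by (auto simp: paths_def awalk_def)

lemma path_start_in_verts: "p \<in> paths G \<Longrightarrow> fst p \<in> verts G"
  by (auto simp: paths_def awalk_def)

lemma path_end_in_verts: "p \<in> paths G \<Longrightarrow> path_end G p \<in> verts G"
  using paths_append[of "fst p" "snd p" "[]"] by simp

lemma path_mult_closed:
  assumes "f \<in> carrier (path_algebra G)" "g \<in> carrier (path_algebra G)"
  shows "f \<otimes>\<^bsub>path_algebra G\<^esub> g \<in> carrier (path_algebra G)"
proof -
  let ?S = "{p. (f \<otimes>\<^bsub>path_algebra G\<^esub> g) p \<noteq> 0}"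
  have "?S \<subseteq> (\<lambda>(p, q). (fst p, snd p @ snd q)) ` ({p. f p \<noteq> 0} \<times> {p. g p \<noteq> 0})"
  proof (clarsimp simp del: path_mult)
    fix u w assume "(f \<otimes>\<^bsub>path_algebra G\<^esub> g) (u, w) \<noteq> 0"
    then obtain i where "f (u, take i w) \<noteq> 0" "g (path_end G (u, take i w), drop i w) \<noteq> 0"
      by (rule path_mult_nonzeroE)
    then show "(u, w) \<in> (\<lambda>(p, q). (fst p, snd p @ snd q)) ` ({p. f p \<noteq> 0} \<times> {p. g p \<noteq> 0})"
      by (intro image_eqI[where x = "((u, take i w), (path_end G (u, take i w), drop i w))"]) auto
  qed
  then have "finite ?S"
    by (rule finite_subset)
      (use assms in \<open>simp add: path_algebra_simps(1) finite_cartesian_product\<close>)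
  moreover have "(u, w) \<in> paths G" if uw: "(u, w) \<in> ?S" for u w
  proof -
    from uw obtain i where "f (u, take i w) \<noteq> 0" "g (path_end G (u, take i w), drop i w) \<noteq> 0"
      by (auto elim: path_mult_nonzeroE)
    then have "(u, take i w) \<in> paths G" "(path_end G (u, take i w), drop i w) \<in> paths G"
      using assms by (auto simp: path_algebra_simps)
    then show ?thesis
      using paths_append[of u "take i w" "drop i w"] by simp
  qed
  ultimately show ?thesis
    by (auto simp: path_algebra_simps)
qed

lemma of_path_carrier: "p \<in> paths G \<Longrightarrow> of_path p \<in> carrier (path_algebra G)"
  by (auto simp: path_algebra_simps of_path_def)

lemma add_carrier:
  assumes "f \<in> carrier (path_algebra G)" "g \<in> carrier (path_algebra G)"
  shows "f \<oplus>\<^bsub>path_algebra G\<^esub> g \<in> carrier (path_algebra G)"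
proof -
  have "{p. f p + g p \<noteq> 0} \<subseteq> {p. f p \<noteq> 0} \<union> {p. g p \<noteq> 0}"
    by auto
  then show ?thesis
    using assms by (auto simp: path_algebra_simps intro: finite_subset)
qed

lemma smult_carrier:
  "f \<in> carrier (path_algebra G) \<Longrightarrow> c \<odot>\<^bsub>path_algebra G\<^esub> f \<in> carrier (path_algebra G)"
  by (auto simp: path_algebra_simps elim: finite_subset[rotated])

lemma restrict_carrier:
  "f \<in> carrier (path_algebra G) \<Longrightarrow> (\<lambda>p. if P p then f p else 0) \<in> carrier (path_algebra G)"
  by (auto simp: path_algebra_simps elim: finite_subset[rotated] split: if_splits)

text \<open>The induction runs through the restrictions of \<open>f\<close> to finite subsets of its
  support. The path case may therefore assume \<open>f p \<noteq> 0\<close>, which permits arguments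
  about the support of this particular \<open>f\<close>.\<close>

lemma path_algebra_induct [consumes 1, case_names zero add path]:
  assumes f: "f \<in> carrier (path_algebra G)"
    and zero: "P \<zero>\<^bsub>path_algebra G\<^esub>"
    and add: "\<And>g h. g \<in> carrier (path_algebra G) \<Longrightarrow> h \<in> carrier (path_algebra G) \<Longrightarrow>
               P g \<Longrightarrow> P h \<Longrightarrow> P (g \<oplus>\<^bsub>path_algebra G\<^esub> h)"
    and path: "\<And>c p. p \<in> paths G \<Longrightarrow> f p \<noteq> 0 \<Longrightarrow> P (c \<odot>\<^bsub>path_algebra G\<^esub> of_path p)"
  shows "P f"
proof -
  have "P (\<lambda>p. if p \<in> A then f p else 0)" if "finite A" "A \<subseteq> {p. f p \<noteq> 0}" for A
    using that
  proof (induction A)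
    case empty
    then show ?case
      using zero by (simp add: path_algebra_simps)
  next
    case (insert p A)
    then have p: "p \<in> paths G" "f p \<noteq> 0"
      using f by (auto simp: path_algebra_simps)
    have eq: "(\<lambda>q. if q \<in> insert p A then f q else 0) =
        (f p \<odot>\<^bsub>path_algebra G\<^esub> of_path p) \<oplus>\<^bsub>path_algebra G\<^esub> (\<lambda>q. if q \<in> A then f q else 0)"
      using insert.hyps by (auto simp: path_algebra_simps of_path_def)
    have "P ((f p \<odot>\<^bsub>path_algebra G\<^esub> of_path p) \<oplus>\<^bsub>path_algebra G\<^esub> (\<lambda>q. if q \<in> A then f q else 0))"
      using insert p f
      by (intro add path smult_carrier of_path_carrier restrict_carrier) auto
    then show ?case
      by (simp only: eq)
  qed
  from this[of "{p. f p \<noteq> 0}"] have "P (\<lambda>p. if f p \<noteq> 0 then f p else 0)"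
    using f by (simp add: path_algebra_simps)
  also have "(\<lambda>p. if f p \<noteq> 0 then f p else 0) = f"
    by auto
  finally show ?thesis .
qed

end

section \<open>Ring structure and ideals of the path algebra\<close>

context fin_digraph
begin

lemma path_algebra_ring: "ring (path_algebra G :: ('k::field, 'a \<times> 'b list \<Rightarrow> 'k) module)"
  (is "ring ?A")
proof (rule ringI)
  show "abelian_group ?A"
  proof (rule abelian_groupI)
    fix f :: "'a \<times> 'b list \<Rightarrow> 'k" assume "f \<in> carrier (path_algebra G)"
    then have "(\<lambda>p. - f p) \<in> carrier (path_algebra G)"
      by (simp add: path_algebra_simps)
    moreover have "(\<lambda>p. - f p) \<oplus>\<^bsub>path_algebra G\<^esub> f = \<zero>\<^bsub>path_algebra G\<^esub>"
      by (simp add: path_algebra_simps)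
    ultimately show "\<exists>g\<in>carrier (path_algebra G). g \<oplus>\<^bsub>path_algebra G\<^esub> f = \<zero>\<^bsub>path_algebra G\<^esub>"
      by blast
  qed (auto simp: add_carrier, auto simp: path_algebra_simps algebra_simps)
next
  show "Group.monoid ?A"
  proof (rule monoidI)
    have "{p :: 'a \<times> 'b list. fst p \<in> verts G \<and> snd p = []} = verts G \<times> {[]}"
      by auto
    then have "finite {p :: 'a \<times> 'b list. fst p \<in> verts G \<and> snd p = []}"
      by simp
    then show "\<one>\<^bsub>?A\<^esub> \<in> carrier ?A"
      by (auto simp: path_algebra_simps elim: finite_subset[rotated])
  next
    fix f :: "'a \<times> 'b list \<Rightarrow> 'k" assume f: "f \<in> carrier (path_algebra G)"
    show "\<one>\<^bsub>path_algebra G\<^esub> \<otimes>\<^bsub>path_algebra G\<^esub> f = f"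
    proof (rule ext, clarify)
      fix u w
      have "(\<one>\<^bsub>path_algebra G\<^esub> \<otimes>\<^bsub>path_algebra G\<^esub> f) (u, w) =
          (\<Sum>i\<le>length w. if i = 0 then (if u \<in> verts G then f (u, w) else 0) else 0)"
        unfolding path_mult by (rule sum.cong) (auto simp: path_algebra_simps)
      then show "(\<one>\<^bsub>path_algebra G\<^esub> \<otimes>\<^bsub>path_algebra G\<^esub> f) (u, w) = f (u, w)"
        using f path_start_in_verts[of "(u, w)"] by (auto simp: path_algebra_simps)
    qed
    show "f \<otimes>\<^bsub>path_algebra G\<^esub> \<one>\<^bsub>path_algebra G\<^esub> = f"
    proof (rule ext, clarify)
      fix u w
      have "(f \<otimes>\<^bsub>path_algebra G\<^esub> \<one>\<^bsub>path_algebra G\<^esub>) (u, w) =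
          (\<Sum>i\<le>length w. if i = length w then (if path_end G (u, w) \<in> verts G then f (u, w) else 0) else 0)"
        unfolding path_mult by (rule sum.cong) (auto simp: path_algebra_simps)
      then show "(f \<otimes>\<^bsub>path_algebra G\<^esub> \<one>\<^bsub>path_algebra G\<^esub>) (u, w) = f (u, w)"
        using f path_end_in_verts[of "(u, w)"] by (auto simp: path_algebra_simps)
    qed
  qed (auto simp: path_mult_closed path_mult_assoc)
qed (auto simp: path_mult_add_left path_mult_add_right)

lemma ideal_of_paths:
  fixes J :: "('a \<times> 'b list \<Rightarrow> 'k::field) set"
  assumes J: "ideal J (path_algebra G)" and f: "f \<in> carrier (path_algebra G)"
    and paths: "\<And>p. p \<in> paths G \<Longrightarrow> f p \<noteq> 0 \<Longrightarrow> of_path p \<in> J"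
  shows "f \<in> J"
proof -
  interpret ideal J "path_algebra G" by (fact J)
  show ?thesis
    using f
  proof (induction rule: path_algebra_induct)
    case (path c p)
    \<comment> \<open>A ring ideal absorbs ring elements only; the scalar \<open>c\<close> enters as
      \<open>c\<close> times the identity.\<close>
    then have "(c \<odot>\<^bsub>path_algebra G\<^esub> \<one>\<^bsub>path_algebra G\<^esub>) \<otimes>\<^bsub>path_algebra G\<^esub> of_path p \<in> J"
      using paths by (intro I_l_closed smult_carrier one_closed) auto
    then show ?case
      using path by (simp add: path_mult_smult_left of_path_carrier)
  qed auto
qed

lemma ideal_smult_closed:
  fixes J :: "('a \<times> 'b list \<Rightarrow> 'k::field) set"
  assumes J: "ideal J (path_algebra G)" and f: "f \<in> J"
  shows "c \<odot>\<^bsub>path_algebra G\<^esub> f \<in> J"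
proof -
  interpret ideal J "path_algebra G" by (fact J)
  have "(c \<odot>\<^bsub>path_algebra G\<^esub> \<one>\<^bsub>path_algebra G\<^esub>) \<otimes>\<^bsub>path_algebra G\<^esub> f \<in> J"
    using f by (intro I_l_closed smult_carrier one_closed) auto
  then show ?thesis
    using f Icarr by (simp add: path_mult_smult_left)
qed

text \<open>Additive inverses come from left multiplication by minus one.\<close>

lemma path_algebra_idealI:
  fixes J :: "('a \<times> 'b list \<Rightarrow> 'k::field) set"
  assumes sub: "J \<subseteq> carrier (path_algebra G)"
    and zero: "\<zero>\<^bsub>path_algebra G\<^esub> \<in> J"
    and add: "\<And>f g. f \<in> J \<Longrightarrow> g \<in> J \<Longrightarrow> f \<oplus>\<^bsub>path_algebra G\<^esub> g \<in> J"
    and left: "\<And>f g. f \<in> J \<Longrightarrow> g \<in> carrier (path_algebra G) \<Longrightarrow> g \<otimes>\<^bsub>path_algebra G\<^esub> f \<in> J"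
    and right: "\<And>f g. f \<in> J \<Longrightarrow> g \<in> carrier (path_algebra G) \<Longrightarrow> f \<otimes>\<^bsub>path_algebra G\<^esub> g \<in> J"
  shows "ideal J (path_algebra G)"
proof -
  interpret ring "path_algebra G :: ('k, 'a \<times> 'b list \<Rightarrow> 'k) module" by (rule path_algebra_ring)
  have "\<ominus>\<^bsub>path_algebra G\<^esub> f \<in> J" if "f \<in> J" for f
  proof -
    have "\<ominus>\<^bsub>path_algebra G\<^esub> \<one>\<^bsub>path_algebra G\<^esub> \<otimes>\<^bsub>path_algebra G\<^esub> f \<in> J"
      using that by (intro left) auto
    then show ?thesis
      using that sub by (auto simp: l_minus)
  qed
  then have "subgroup J (add_monoid (path_algebra G))"
    using assms by (intro add.subgroupI) (auto simp: a_inv_def)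
  then show ?thesis
    using left right by (intro idealI path_algebra_ring) auto
qed

lemma minus_path_algebra:
  assumes "f \<in> carrier (path_algebra G)" "g \<in> carrier (path_algebra G)"
  shows "f \<ominus>\<^bsub>path_algebra G\<^esub> g = (\<lambda>p. f p - g p :: 'k::field)"
proof -
  interpret ring "path_algebra G :: ('k, 'a \<times> 'b list \<Rightarrow> 'k) module" by (rule path_algebra_ring)
  have "(\<lambda>p. - g p) \<in> carrier (path_algebra G)"
    using assms by (simp add: path_algebra_simps)
  then have "\<ominus>\<^bsub>path_algebra G\<^esub> g = (\<lambda>p. - g p)"
    using assms by (intro minus_equality) (auto simp: path_algebra_simps)
  then show ?thesis
    by (simp add: a_minus_def path_algebra_simps)
qed

end

section \<open>Almost gentle algebras and their maximal paths\<close>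

text \<open>\<open>R\<close> is functional, so a chain is forced by its first element and two chains
  from the same start can differ only in length. This is the common core of the uniqueness arguments
  for maximal paths and for cycles.\<close>

lemma successively_prefix_cases:
  assumes "\<And>x y z. R x y \<Longrightarrow> R x z \<Longrightarrow> y = z"
    and "successively R (a # xs)" "successively R (a # ys)"
  shows "prefix xs ys \<or> prefix ys xs"
  using assms(2,3)
proof (induction xs arbitrary: a ys)
  case (Cons x xs)
  then show ?case
  proof (cases ys)
    case (Cons y ys')
    with Cons.prems have "x = y"
      using assms(1)[of a x y] by simp
    with Cons Cons.prems Cons.IH[of x ys'] show ?thesis
      by simp
  qed simp
qed simp

lemma successively_mono_sublist: "successively R ys \<Longrightarrow> sublist xs ys \<Longrightarrow> successively R xs"
  by (auto simp: sublist_def successively_append_iff)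

lemma not_successively_iff:
  "\<not> successively R xs \<longleftrightarrow> (\<exists>ys a b zs. xs = ys @ [a, b] @ zs \<and> \<not> R a b)"
proof
  show "\<not> successively R xs \<Longrightarrow> \<exists>ys a b zs. xs = ys @ [a, b] @ zs \<and> \<not> R a b"
  proof (induction R xs rule: successively.induct)
    case (3 P x y xs)
    show ?case
    proof (cases "P x y")
      case True
      with 3 obtain ys a b zs where "y # xs = ys @ [a, b] @ zs" "\<not> P a b"
        by auto
      then show ?thesis
        by (intro exI[of _ "x # ys"]) auto
    next
      case False
      then show ?thesis
        by (intro exI[of _ "[]"]) auto
    qed
  qed auto
qed (auto simp: successively_append_iff)

locale almost_gentle_algebra = fin_digraph Q
  for Q :: "('v, 'a) pre_digraph" +
  fixes I :: "(('v, 'a) qpath \<Rightarrow> 'k::field) set"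
  assumes admissible: "admissible Q I" and almost_gentle: "almost_gentle Q I"
begin

abbreviation KQ :: "('k, ('v, 'a) qpath \<Rightarrow> 'k) module" where
  "KQ \<equiv> path_algebra Q"

text \<open>Their cosets are the path basis of \<open>A\<close>; this is what
  \<open>mem_I_iff\<close> amounts to.\<close>

definition nonzero_paths :: "('v, 'a) qpath set" where
  "nonzero_paths = {p \<in> paths Q. of_path p \<notin> I}"

definition nz :: "'a \<Rightarrow> 'a \<Rightarrow> bool" where
  "nz a b \<longleftrightarrow> (tail Q a, [a, b]) \<in> nonzero_paths"

sublocale KQ: ring KQ
  by (rule path_algebra_ring)

lemma ideal_I: "ideal I KQ"
  using admissible by (simp add: admissible_def)

sublocale I: ideal I KQ
  by (rule ideal_I)

lemma nonzero_paths_append: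
  assumes "(u, p @ q) \<in> nonzero_paths"
  shows "(u, p) \<in> nonzero_paths" "(path_end Q (u, p), q) \<in> nonzero_paths"
proof -
  have *: "of_path (u, p) \<otimes>\<^bsub>KQ\<^esub> of_path (path_end Q (u, p), q) = (of_path (u, p @ q) :: _ \<Rightarrow> 'k)"
    by (simp add: of_path_mult)
  have "(u, p) \<in> paths Q" "(path_end Q (u, p), q) \<in> paths Q"
    using assms by (auto simp: nonzero_paths_def paths_append)
  then show "(u, p) \<in> nonzero_paths" "(path_end Q (u, p), q) \<in> nonzero_paths"
    using assms I.I_l_closed[of "of_path (path_end Q (u, p), q)" "of_path (u, p)"]
      I.I_r_closed[of "of_path (u, p)" "of_path (path_end Q (u, p), q)"]
    by (auto simp: nonzero_paths_def * of_path_carrier)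
qed

lemma nonzero_paths_in_paths: "p \<in> nonzero_paths \<Longrightarrow> p \<in> paths Q"
  by (simp add: nonzero_paths_def)

text \<open>The elements supported on paths that contain a relation form an ideal around the
  generators, hence around \<open>I\<close>. This bounds the support of an element of
  \<open>I\<close> without writing it as a sum of products.\<close>

lemma relations:
  obtains P where "P \<subseteq> {p \<in> paths Q. length (snd p) = 2}"
    "\<And>p. p \<in> P \<Longrightarrow> of_path p \<in> I"
    "\<And>f p. f \<in> I \<Longrightarrow> f p \<noteq> 0 \<Longrightarrow> \<exists>r\<in>P. sublist (snd r) (snd p)"
proof -
  obtain P where P: "P \<subseteq> {p \<in> paths Q. length (snd p) = 2}" and I: "I = Idl\<^bsub>KQ\<^esub> (of_path ` P)"
    using almost_gentle by (auto simp: almost_gentle_def)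
  have sub: "of_path ` P \<subseteq> carrier KQ"
    using P by (auto intro: of_path_carrier)
  define J where "J = {f \<in> carrier KQ. \<forall>p. f p \<noteq> 0 \<longrightarrow> (\<exists>r\<in>P. sublist (snd r) (snd p))}"
  have "ideal J KQ"
  proof (rule path_algebra_idealI)
    show "f \<oplus>\<^bsub>KQ\<^esub> g \<in> J" if "f \<in> J" "g \<in> J" for f g
    proof -
      have "\<exists>r\<in>P. sublist (snd r) (snd p)" if "f p + g p \<noteq> 0" for p
      proof -
        have "f p \<noteq> 0 \<or> g p \<noteq> 0"
          using that by auto
        then show ?thesis
          using \<open>f \<in> J\<close> \<open>g \<in> J\<close> unfolding J_def by blast
      qed
      moreover have "f \<oplus>\<^bsub>KQ\<^esub> g \<in> carrier KQ"
        using that by (auto simp: J_def intro: KQ.a_closed)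
      ultimately show ?thesis
        unfolding J_def path_algebra_simps(4) by blast
    qed
  next
    have mult: "\<exists>r\<in>P. sublist (snd r) (snd p)"
      if J: "f \<in> J \<or> g \<in> J" and nonzero: "(f \<otimes>\<^bsub>KQ\<^esub> g) p \<noteq> 0" for f g p
    proof -
      obtain u w where p: "p = (u, w)"
        by (cases p)
      obtain i where "f (u, take i w) \<noteq> 0" "g (path_end Q (u, take i w), drop i w) \<noteq> 0"
        using nonzero unfolding p by (rule path_mult_nonzeroE)
      with J have "\<exists>r\<in>P. sublist (snd r) (take i w) \<or> sublist (snd r) (drop i w)"
        by (fastforce simp: J_def)
      then show ?thesis
        unfolding p by (metis snd_conv sublist_drop sublist_order.order.trans sublist_take)
    qed
    show "g \<otimes>\<^bsub>KQ\<^esub> f \<in> J" if "f \<in> J" "g \<in> carrier KQ" for f g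
      using that mult[of g f] path_mult_closed[of g f] unfolding J_def by blast
    show "f \<otimes>\<^bsub>KQ\<^esub> g \<in> J" if "f \<in> J" "g \<in> carrier KQ" for f g
      using that mult[of f g] path_mult_closed[of f g] unfolding J_def by blast
    show "\<zero>\<^bsub>KQ\<^esub> \<in> J"
      using KQ.zero_closed unfolding J_def by (simp add: path_algebra_simps(3))
  qed (auto simp: J_def)
  moreover have "of_path ` P \<subseteq> J"
  proof (rule image_subsetI)
    fix p assume p: "p \<in> P"
    have "\<exists>r\<in>P. sublist (snd r) (snd q)" if "of_path p q \<noteq> (0 :: 'k)" for q
    proof -
      have "q = p"
        using that by (simp add: of_path_def split: if_splits)
      then show ?thesis
        using p by blast
    qed
    then show "of_path p \<in> J"
      using sub p unfolding J_def by blast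
  qed
  ultimately have "I \<subseteq> J"
    unfolding I by (rule KQ.genideal_minimal)
  show ?thesis
  proof (rule that[of P])
    show "of_path p \<in> I" if "p \<in> P" for p
      using KQ.genideal_self[OF sub] that unfolding I by blast
    show "\<exists>r\<in>P. sublist (snd r) (snd p)" if "f \<in> I" "f p \<noteq> 0" for f p
      using \<open>I \<subseteq> J\<close> that unfolding J_def by blast
  qed (rule P)
qed

text \<open>All relations have length two, so a path falls into \<open>I\<close> only through two
  consecutive arrows. In particular trivial paths and single arrows are nonzero.\<close>

lemma nonzero_paths_iff:
  "(u, p) \<in> nonzero_paths \<longleftrightarrow> (u, p) \<in> paths Q \<and> successively nz p"
proof
  assume p: "(u, p) \<in> nonzero_paths"
  have "nz a b" if "p = ys @ [a, b] @ zs" for ys a b zs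
  proof -
    have "(path_end Q (u, ys), [a, b]) \<in> nonzero_paths"
      using p nonzero_paths_append that by metis
    then show ?thesis
      by (auto simp: nz_def nonzero_paths_def)
  qed
  then show "(u, p) \<in> paths Q \<and> successively nz p"
    using p not_successively_iff[of nz p] by (auto dest: nonzero_paths_in_paths)
next
  assume p: "(u, p) \<in> paths Q \<and> successively nz p"
  obtain P where P: "P \<subseteq> {p \<in> paths Q. length (snd p) = 2}"
    "\<And>p. p \<in> P \<Longrightarrow> of_path p \<in> I"
    "\<And>f p. f \<in> I \<Longrightarrow> f p \<noteq> 0 \<Longrightarrow> \<exists>r\<in>P. sublist (snd r) (snd p)"
    using relations by blast
  show "(u, p) \<in> nonzero_paths"
  proof (rule ccontr)
    assume "(u, p) \<notin> nonzero_paths"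
    then have "of_path (u, p) \<in> I"
      using p by (simp add: nonzero_paths_def)
    from P(3)[OF this, of "(u, p)"] obtain r where r: "r \<in> P" "sublist (snd r) p"
      by (auto simp: of_path_def)
    with P(1) obtain v a b where v: "r = (v, [a, b])" "(v, [a, b]) \<in> paths Q"
      by (cases r) (auto simp: length_Suc_conv numeral_2_eq_2)
    have "nz a b"
      using successively_mono_sublist[of nz p "[a, b]"] p r v by simp
    then show False
      using P(2)[OF r(1)] v by (auto simp: nz_def nonzero_paths_def)
  qed
qed

lemma nzD: "nz a b \<Longrightarrow> a \<in> arcs Q \<and> b \<in> arcs Q \<and> head Q a = tail Q b"
  by (auto simp: nz_def nonzero_paths_def)

text \<open>\<open>I\<close> is generated by paths, so membership is decided coefficient by
  coefficient: a relation inside a nonzero path would itself be a nonzero path.\<close>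

lemma mem_I_iff: "f \<in> I \<longleftrightarrow> f \<in> carrier KQ \<and> (\<forall>p\<in>nonzero_paths. f p = 0)"
proof
  assume f: "f \<in> I"
  obtain P where P: "P \<subseteq> {p \<in> paths Q. length (snd p) = 2}"
    "\<And>p. p \<in> P \<Longrightarrow> of_path p \<in> I"
    "\<And>f p. f \<in> I \<Longrightarrow> f p \<noteq> 0 \<Longrightarrow> \<exists>r\<in>P. sublist (snd r) (snd p)"
    using relations by blast
  have "f (u, p) = 0" if p: "(u, p) \<in> nonzero_paths" for u p
  proof (rule ccontr)
    assume "f (u, p) \<noteq> 0"
    then obtain r where r: "r \<in> P" "sublist (snd r) p"
      using P(3) f by fastforce
    then obtain x y where "p = x @ snd r @ y"
      by (auto simp: sublist_def)
    then have *: "(path_end Q (u, x), snd r) \<in> nonzero_paths"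
      using p nonzero_paths_append by metis
    \<comment> \<open>\<open>sublist\<close> compares arrow lists only. The start vertex agrees
      because a relation has arrows and its first arrow determines the vertex.\<close>
    moreover have "r = (path_end Q (u, x), snd r)"
      using r(1) P(1) * by (cases r; cases "snd r") (auto simp: nonzero_paths_def)
    ultimately show False
      using P(2)[OF r(1)] by (simp add: nonzero_paths_def)
  qed
  then show "f \<in> carrier KQ \<and> (\<forall>p\<in>nonzero_paths. f p = 0)"
    using f I.Icarr by auto
next
  assume "f \<in> carrier KQ \<and> (\<forall>p\<in>nonzero_paths. f p = 0)"
  then show "f \<in> I"
    by (intro ideal_of_paths[OF ideal_I, of f]) (auto simp: nonzero_paths_def)
qed

lemma of_arrow_mult_mem_I_iff:
  assumes "a \<in> arcs Q" "b \<in> arcs Q"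
  shows "(of_arrow Q a \<otimes>\<^bsub>KQ\<^esub> of_arrow Q b :: _ \<Rightarrow> 'k) \<notin> I \<longleftrightarrow> nz a b"
  using assms KQ.zero_closed I.zero_closed
  by (auto simp: of_arrow_def of_path_mult nz_def nonzero_paths_def path_algebra_simps(3))

lemma nz_right_unique:
  assumes "nz a b" "nz a c"
  shows "b = c"
proof -
  have "a \<in> arcs Q" "b \<in> arcs Q" "c \<in> arcs Q"
    using assms nzD by auto
  moreover from this have "\<exists>\<^sub>\<le>\<^sub>1b. b \<in> arcs Q \<and> of_arrow Q a \<otimes>\<^bsub>KQ\<^esub> of_arrow Q b \<notin> I"
    using almost_gentle unfolding almost_gentle_def by blast
  ultimately show ?thesis
    using assms by (simp add: Uniq_def flip: of_arrow_mult_mem_I_iff)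
qed

lemma nz_left_unique:
  assumes "nz b a" "nz c a"
  shows "b = c"
proof -
  have "a \<in> arcs Q" "b \<in> arcs Q" "c \<in> arcs Q"
    using assms nzD by auto
  moreover from this have "\<exists>\<^sub>\<le>\<^sub>1b. b \<in> arcs Q \<and> of_arrow Q b \<otimes>\<^bsub>KQ\<^esub> of_arrow Q a \<notin> I"
    using almost_gentle unfolding almost_gentle_def by blast
  ultimately show ?thesis
    using assms by (simp add: Uniq_def flip: of_arrow_mult_mem_I_iff)
qed

text \<open>Arrows are split off at the end of the path because powers of an ideal are built by
  multiplication on the right.\<close>

lemma path_mem_arrow_ideal_pow:
  "(u, p) \<in> paths Q \<Longrightarrow>
     (of_path (u, p) :: _ \<Rightarrow> 'k) \<in> arrow_ideal Q [^]\<^bsub>ideals_set KQ\<^esub> length p"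
proof (induction p rule: rev_induct)
  case Nil
  then show ?case
    by (simp add: nat_pow_def ideals_set_def of_path_carrier)
next
  case (snoc e p)
  then have e: "e \<in> arcs Q" "(u, p) \<in> paths Q" "path_end Q (u, p) = tail Q e"
    by (auto simp: paths_append)
  have "of_arrow Q ` arcs Q \<subseteq> carrier KQ"
    by (auto simp: of_arrow_def intro!: of_path_carrier)
  then have "of_arrow Q e \<in> (arrow_ideal Q :: (_ \<Rightarrow> 'k) set)"
    using subsetD[OF KQ.genideal_self] e unfolding arrow_ideal_def by blast
  then have "of_path (u, p) \<otimes>\<^bsub>KQ\<^esub> of_arrow Q e \<in> (arrow_ideal Q [^]\<^bsub>ideals_set KQ\<^esub> length p) \<cdot>\<^bsub>KQ\<^esub> arrow_ideal Q"
    using snoc.IH e by (intro ideal_prod.prod) auto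
  then show ?case
    using e by (simp add: nat_pow_def ideals_set_def of_path_mult of_arrow_def)
qed

text \<open>The power \<open>N\<close> of the arrow ideal inside \<open>I\<close> contains every
  path of length \<open>N\<close>, and a longer path has such a path as an initial segment.\<close>

lemma length_nonzero_paths: "\<exists>N. \<forall>p\<in>nonzero_paths. length (snd p) < N"
proof -
  obtain N :: nat where N: "arrow_ideal Q [^]\<^bsub>ideals_set KQ\<^esub> N \<subseteq> I"
    using admissible by (auto simp: admissible_def)
  have False if "(u, p) \<in> nonzero_paths" "N \<le> length p" for u p
  proof -
    have *: "(u, take N p) \<in> nonzero_paths"
      using that nonzero_paths_append(1)[of u "take N p" "drop N p"] by simp
    moreover have "length (take N p) = N"
      using that by simp
    ultimately have "of_path (u, take N p) \<in> I"
      using path_mem_arrow_ideal_pow[of u "take N p"] N nonzero_paths_in_paths by auto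
    with * show False
      by (simp add: nonzero_paths_def)
  qed
  then show ?thesis
    by (intro exI[of _ N]) (force simp flip: not_le)
qed

lemma finite_nonzero_paths: "finite nonzero_paths"
proof -
  obtain N where N: "\<forall>p\<in>nonzero_paths. length (snd p) < N"
    using length_nonzero_paths by blast
  have "nonzero_paths \<subseteq> verts Q \<times> {xs. set xs \<subseteq> arcs Q \<and> length xs \<le> N}"
    using N paths_arcs path_start_in_verts by (fastforce simp: nonzero_paths_def)
  then show ?thesis
    by (rule finite_subset) (simp add: finite_lists_length_le)
qed


section \<open>Maximal paths: existence and uniqueness\<close>

abbreviation \<M> :: "('v, 'a) qpath set" where
  "\<M> \<equiv> maximal_paths Q I"

text \<open>The two sides differ because a path stores its start vertex. For trivial
  \<open>m\<close> the list \<open>a # snd m\<close> does not see the vertex \<open>fst m\<close>,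
  so composability on the left has to be required; on the right it is part of being a path.\<close>

lemma maximal_paths_iff:
  "m \<in> \<M> \<longleftrightarrow> m \<in> nonzero_paths \<and>
     (\<forall>a\<in>arcs Q. head Q a = fst m \<longrightarrow> (tail Q a, a # snd m) \<notin> nonzero_paths) \<and>
     (\<forall>a. (fst m, snd m @ [a]) \<notin> nonzero_paths)"
proof (cases "m \<in> nonzero_paths")
  case True
  then have m: "m \<in> paths Q" "(fst m, snd m) \<in> paths Q"
    by (auto simp: nonzero_paths_def)
  have "(of_arrow Q a \<otimes>\<^bsub>KQ\<^esub> of_path m :: _ \<Rightarrow> 'k) \<in> I \<longleftrightarrow>
        (head Q a = fst m \<longrightarrow> (tail Q a, a # snd m) \<notin> nonzero_paths)"
    "(of_path m \<otimes>\<^bsub>KQ\<^esub> of_arrow Q a :: _ \<Rightarrow> 'k) \<in> I \<longleftrightarrow>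
       (fst m, snd m @ [a]) \<notin> nonzero_paths" if "a \<in> arcs Q" for a
    using that m I.zero_closed
    by (auto simp: of_arrow_def of_path_mult nonzero_paths_def paths_append path_algebra_simps(3))
  moreover have "a \<in> arcs Q" if "(fst m, snd m @ [a]) \<in> nonzero_paths" for a
    using that by (simp add: nonzero_paths_def paths_append)
  ultimately show ?thesis
    using True by (auto simp: maximal_paths_def nonzero_paths_def)
qed (auto simp: maximal_paths_def nonzero_paths_def)

lemma finite_maximal_paths: "finite \<M>"
  using finite_nonzero_paths by (rule rev_finite_subset) (auto simp: maximal_paths_iff)

text \<open>A path that is not maximal is prolonged by one arrow at either end, and the bound on
  lengths stops this. The condition on \<open>path_end\<close> fixes the position of a trivial
  \<open>p\<close>, which its empty arrow list cannot do.\<close>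

lemma subpath_of_maximal_path:
  assumes "p \<in> nonzero_paths"
  obtains m x y where "m \<in> \<M>" "snd m = x @ snd p @ y" "path_end Q (fst m, x) = fst p"
proof -
  obtain N where N: "\<forall>p\<in>nonzero_paths. length (snd p) < N"
    using length_nonzero_paths by blast
  have "\<exists>m x y. m \<in> \<M> \<and> snd m = x @ snd p @ y \<and> path_end Q (fst m, x) = fst p"
    using assms
  proof (induction "N - length (snd p)" arbitrary: p rule: less_induct)
    case less
    show ?case
    proof (cases "p \<in> \<M>")
      case True
      then show ?thesis
        by (intro exI[of _ p] exI[of _ "[]"]) simp
    next
      case False
      then consider a where "a \<in> arcs Q" "head Q a = fst p" "(tail Q a, a # snd p) \<in> nonzero_paths"
        | a where "(fst p, snd p @ [a]) \<in> nonzero_paths"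
        using less.prems by (auto simp: maximal_paths_iff)
      then show ?thesis
      proof cases
        case 1
        then have "N - length (snd (tail Q a, a # snd p)) < N - length (snd p)"
          using N less.prems by (simp add: diff_less_mono2)
        from less.hyps[OF this 1(3)] obtain m x y where
          "m \<in> \<M>" "snd m = (x @ [a]) @ snd p @ y" by auto
        then show ?thesis
          using 1 by (intro exI[of _ m] exI[of _ "x @ [a]"] exI[of _ y]) simp
      next
        case 2
        then have "N - length (snd (fst p, snd p @ [a])) < N - length (snd p)"
          using N less.prems by (simp add: diff_less_mono2)
        from less.hyps[OF this 2] obtain m x y where
          "m \<in> \<M>" "snd m = x @ snd p @ ([a] @ y)" "path_end Q (fst m, x) = fst p" by auto
        then show ?thesis
          by blast
      qed
    qed
  qed
  with that show ?thesis
    by blast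
qed

text \<open>After the common arrow both paths follow the same functional relation, so one
  continuation is a prefix of the other. If \<open>y'\<close> went beyond \<open>y\<close>, its next
  arrow would prolong \<open>m\<close>.\<close>

lemma maximal_path_right_unique:
  assumes "m \<in> \<M>" "m' \<in> \<M>" "snd m = x @ a # y" "snd m' = x' @ a # y'"
  shows "prefix y' y"
proof -
  have m: "successively nz (snd m)" "successively nz (snd m')" "(fst m, snd m) \<in> paths Q"
    using assms(1,2) nonzero_paths_iff[of "fst m" "snd m"] nonzero_paths_iff[of "fst m'" "snd m'"]
    by (auto simp: maximal_paths_iff)
  have "prefix y y' \<or> prefix y' y"
    using m assms(3,4)
    by (intro successively_prefix_cases[of nz a] nz_right_unique) (auto simp: successively_append_iff)
  moreover have False if y: "y' = y @ b # z" for b z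
  proof -
    have "nz (last (a # y)) b"
      using m(2) unfolding assms(4) y by (auto simp: successively_append_iff successively_Cons split: if_splits)
    then have "nz (last (snd m)) b"
      using assms(3) by simp
    moreover have "path_end Q (fst m, snd m) = head Q (last (snd m))"
      using path_end_snoc[of Q "fst m" "butlast (snd m)" "last (snd m)"] assms(3)
      by (metis append_butlast_last_id append_is_Nil_conv list.distinct(1))
    ultimately have "(fst m, snd m @ [b]) \<in> nonzero_paths"
      using m nzD[of "last (snd m)" b]
      by (simp add: nonzero_paths_iff successively_append_iff paths_append)
    then show False
      using assms(1) by (simp add: maximal_paths_iff)
  qed
  ultimately show ?thesis
    by (metis neq_Nil_conv prefix_def self_append_conv)
qed

text \<open>The mirror image of the argument on the right: reversal turns predecessors into
  successors, which are unique by the other half of (S1).\<close>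

lemma maximal_path_left_unique:
  assumes "m \<in> \<M>" "m' \<in> \<M>" "snd m = x @ a # y" "snd m' = x' @ a # y'"
  shows "suffix x' x"
proof -
  have m: "successively nz (snd m)" "successively nz (snd m')" "(fst m, snd m) \<in> paths Q"
    using assms(1,2) nonzero_paths_iff[of "fst m" "snd m"] nonzero_paths_iff[of "fst m'" "snd m'"]
    by (auto simp: maximal_paths_iff)
  have "successively nz (x @ [a])" "successively nz (x' @ [a])"
    using m assms(3,4) by (auto simp: successively_append_iff)
  then have "successively (\<lambda>b c. nz c b) (a # rev x)" "successively (\<lambda>b c. nz c b) (a # rev x')"
    using successively_rev[of "\<lambda>b c. nz c b" "x @ [a]"]
      successively_rev[of "\<lambda>b c. nz c b" "x' @ [a]"] by simp_all
  then have "prefix (rev x) (rev x') \<or> prefix (rev x') (rev x)"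
    by (rule successively_prefix_cases[rotated]) (rule nz_left_unique)
  then have "suffix x x' \<or> suffix x' x"
    by (simp add: suffix_to_prefix)
  moreover have False if x: "x' = z @ b # x" for b z
  proof -
    \<comment> \<open>\<open>hd (x @ [a])\<close> is the first arrow of \<open>m\<close>, also when
      \<open>x\<close> is empty.\<close>
    have "nz b (hd (x @ [a]))"
      using m(2) unfolding assms(4) x by (cases x) (auto simp: successively_append_iff successively_Cons)
    moreover have "fst m = tail Q (hd (x @ [a]))"
      using m(3) assms(3) by (cases x) auto
    ultimately have "b \<in> arcs Q" "head Q b = fst m" "(tail Q b, b # snd m) \<in> nonzero_paths"
      using m nzD[of b "hd (x @ [a])"] assms(3)
      by (cases x; auto simp: nonzero_paths_iff successively_Cons)+
    then show False
      using assms(1) by (simp add: maximal_paths_iff)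
  qed
  ultimately show ?thesis
    by (metis append_Cons append_butlast_last_id append_eq_append_conv2 append_Nil suffix_def append.assoc)
qed

text \<open>The one-sided results, used in both orders, settle the arrow lists. Since these contain
  \<open>a\<close>, their first arrows also determine the start vertices.\<close>

lemma maximal_path_unique:
  assumes "m \<in> \<M>" "m' \<in> \<M>" "snd m = x @ a # y" "snd m' = x' @ a # y'"
  shows "m = m' \<and> x = x' \<and> y = y'"
proof -
  have "y = y'" "x = x'"
    using maximal_path_right_unique[OF assms] maximal_path_right_unique[OF assms(2,1,4,3)]
      maximal_path_left_unique[OF assms] maximal_path_left_unique[OF assms(2,1,4,3)]
    by (auto intro: prefix_order.antisym suffix_order.antisym)
  moreover have "fst m = tail Q (hd (snd m))" "fst m' = tail Q (hd (snd m'))"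
    using assms by (cases m; cases m'; cases x; cases x'; auto simp: maximal_paths_iff nonzero_paths_def)+
  ultimately show ?thesis
    using assms by (simp add: prod_eq_iff)
qed

end

section \<open>The cycles of the quiver \<open>Q\<^sup>*\<close>\<close>

context almost_gentle_algebra
begin

abbreviation Qs :: "('v, 'a + ('v, 'a) qpath) pre_digraph" where
  "Qs \<equiv> star_quiver Q I"

abbreviation \<S> :: "('v, 'a + ('v, 'a) qpath) qpath set" where
  "\<S> \<equiv> cycles Q I"

abbreviation KQs :: "('k, ('v, 'a + ('v, 'a) qpath) qpath \<Rightarrow> 'k) module" where
  "KQs \<equiv> path_algebra Qs"

lemma star_quiver_simps [simp]:
  "verts Qs = verts Q" "arcs Qs = Inl ` arcs Q \<union> Inr ` \<M>"
  "tail Qs (Inl a) = tail Q a" "head Qs (Inl a) = head Q a"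
  "tail Qs (Inr m) = path_end Q m" "head Qs (Inr m) = fst m"
  by (simp_all add: star_quiver_def)

lemma maximal_path_in_paths: "m \<in> \<M> \<Longrightarrow> m \<in> paths Q"
  by (simp add: maximal_paths_def)

text \<open>Finiteness of \<open>\<M>\<close> keeps \<open>Qs\<close> finite, so all results on path
  algebras become available for \<open>KQs\<close>.\<close>

sublocale star: fin_digraph Qs
proof
  show "finite (verts Qs)" "finite (arcs Qs)"
    using finite_maximal_paths by simp_all
next
  fix e assume "e \<in> arcs Qs"
  moreover have "\<forall>m\<in>\<M>. path_end Q m \<in> verts Q \<and> fst m \<in> verts Q"
    using maximal_path_in_paths path_end_in_verts path_start_in_verts by blast
  ultimately show "tail Qs e \<in> verts Qs" "head Qs e \<in> verts Qs"
    by (auto simp del: split_paired_All)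
qed

sublocale KQs: ring KQs
  by (rule star.path_algebra_ring)

lemma path_end_map_Inl [simp]: "path_end Qs (u, map Inl p) = path_end Q (u, p)"
  by (induction p arbitrary: u) simp_all

lemma paths_map_Inl [simp]: "(u, map Inl p) \<in> paths Qs \<longleftrightarrow> (u, p) \<in> paths Q"
  by (induction p arbitrary: u) auto

lemma maximal_path_split:
  assumes "m \<in> \<M>" "snd m = x @ y"
  shows "(fst m, x) \<in> paths Q" "(path_end Q (fst m, x), y) \<in> paths Q"
    "path_end Q m = path_end Q (path_end Q (fst m, x), y)"
  using maximal_path_in_paths[OF assms(1)] assms(2) paths_append[of "fst m" x y]
    path_end_append[of Q "fst m" x y]
  by (cases m; simp)+

lemma tail_hd_cycle:
  assumes "m \<in> \<M>" "snd m = x @ y"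
  shows "tail Qs (hd (map Inl y @ Inr m # map Inl x)) = path_end Q (fst m, x)"
  using maximal_path_split[OF assms] by (cases y) auto

text \<open>A rotation of a maximal cycle corresponds to a cut of \<open>m\<close> into
  \<open>x\<close> and \<open>y\<close> and starts at the vertex of the cut. Empty \<open>x\<close>
  gives the cycle itself, empty \<open>y\<close> the rotation that begins with the new
  arrow.\<close>

lemma cycles_iff:
  "C \<in> \<S> \<longleftrightarrow>
     (\<exists>m\<in>\<M>. \<exists>x y. snd m = x @ y \<and> C = (path_end Q (fst m, x), map Inl y @ Inr m # map Inl x))"
proof
  assume "C \<in> \<S>"
  then obtain m i where m: "m \<in> \<M>" and
    C: "C = (tail Qs (hd (rotate i (max_cycle m))), rotate i (max_cycle m))"
    by (auto simp: cycles_def)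
  define k where "k = i mod length (max_cycle m)"
  have "k < length (max_cycle m)"
    unfolding k_def by (rule mod_less_divisor) (simp add: max_cycle_def)
  \<comment> \<open>The cycle has one arrow more than \<open>m\<close>, so \<open>k\<close> is an
    admissible cut of \<open>m\<close>, its end included.\<close>
  then have "k \<le> length (snd m)"
    by (simp add: max_cycle_def)
  then have "rotate i (max_cycle m) = map Inl (drop k (snd m)) @ Inr m # map Inl (take k (snd m))"
    by (simp add: rotate_drop_take flip: k_def) (simp add: max_cycle_def drop_map take_map)
  with C m tail_hd_cycle[of m "take k (snd m)" "drop k (snd m)"]
  show "\<exists>m\<in>\<M>. \<exists>x y. snd m = x @ y \<and> C = (path_end Q (fst m, x), map Inl y @ Inr m # map Inl x)"
    by (intro bexI[of _ m] exI[of _ "take k (snd m)"] exI[of _ "drop k (snd m)"]) simp_all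
next
  assume "\<exists>m\<in>\<M>. \<exists>x y. snd m = x @ y \<and> C = (path_end Q (fst m, x), map Inl y @ Inr m # map Inl x)"
  then obtain m x y where m: "m \<in> \<M>" "snd m = x @ y"
    and C: "C = (path_end Q (fst m, x), map Inl y @ Inr m # map Inl x)"
    by blast
  have "map Inl y @ Inr m # map Inl x = rotate (length x) (max_cycle m)"
    using rotate_append[of "map Inl x" "map Inl y @ [Inr m]"] m(2) by (simp add: max_cycle_def)
  then show "C \<in> \<S>"
    using m C tail_hd_cycle[OF m] unfolding cycles_def by (simp, blast)
qed

lemma cyclesE:
  assumes "C \<in> \<S>"
  obtains m x y where "m \<in> \<M>" "snd m = x @ y"
    "C = (path_end Q (fst m, x), map Inl y @ Inr m # map Inl x)"
  using assms unfolding cycles_iff by blast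

lemma finite_cycles: "finite \<S>"
proof -
  let ?c = "\<lambda>m i. (path_end Q (fst m, take i (snd m)),
    map Inl (drop i (snd m)) @ Inr m # map Inl (take i (snd m)))"
  have "\<S> \<subseteq> (\<Union>m\<in>\<M>. ?c m ` {..length (snd m)})"
  proof
    fix C assume "C \<in> \<S>"
    then obtain m x y where m: "m \<in> \<M>" "snd m = x @ y"
      "C = (path_end Q (fst m, x), map Inl y @ Inr m # map Inl x)"
      by (rule cyclesE)
    then have "C = ?c m (length x)" "length x \<le> length (snd m)"
      by auto
    with m(1) show "C \<in> (\<Union>m\<in>\<M>. ?c m ` {..length (snd m)})"
      by blast
  qed
  then show ?thesis
    by (rule finite_subset) (simp add: finite_maximal_paths)
qed

lemma cycle_in_paths: "C \<in> \<S> \<Longrightarrow> C \<in> paths Qs"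
  and cycle_closed: "C \<in> \<S> \<Longrightarrow> path_end Qs C = fst C"
  by (erule cyclesE, simp add: star.paths_append path_end_append maximal_path_split)+

lemma cycle_nonempty: "C \<in> \<S> \<Longrightarrow> snd C \<noteq> []"
  by (erule cyclesE) simp

lemma cycle_one_new_arrow: "C \<in> \<S> \<Longrightarrow> length (filter (\<lambda>a. \<not> isl a) (snd C)) = 1"
  by (erule cyclesE) simp

lemma cycle_rotate:
  assumes "(u, p @ q) \<in> \<S>"
  shows "(path_end Qs (u, p), q @ p) \<in> \<S>"
proof -
  obtain m i where m: "m \<in> \<M>" "p @ q = rotate i (max_cycle m)"
    using assms by (auto simp: cycles_def)
  then have "q @ p = rotate (length p + i) (max_cycle m)"
    by (metis rotate_append rotate_rotate)
  moreover have "tail Qs (hd (q @ p)) = path_end Qs (u, p)"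
  \<comment> \<open>For empty \<open>q\<close> the arrow list is unchanged, and the end of
    \<open>p\<close> is its start because cycles are closed.\<close>
  proof (cases q)
    case Nil
    then show ?thesis
      using cycle_closed[OF assms] cycle_in_paths[OF assms] cycle_nonempty[OF assms]
      by (cases p) auto
  next
    case (Cons a q')
    then show ?thesis
      using cycle_in_paths[OF assms] by (simp add: star.paths_append)
  qed
  ultimately show ?thesis
    using m(1) unfolding cycles_def by (metis (mono_tags, lifting) mem_Collect_eq)
qed

text \<open>A new first arrow names its maximal path and forces the cut at its end; an old first
  arrow lies in only one maximal path, at one place.\<close>

lemma cycle_unique:
  assumes "C \<in> \<S>" "C' \<in> \<S>" "hd (snd C) = hd (snd C')"
  shows "C = C'"
proof -
  obtain m x y where m: "m \<in> \<M>" "snd m = x @ y"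
    "C = (path_end Q (fst m, x), map Inl y @ Inr m # map Inl x)"
    using assms(1) by (rule cyclesE)
  obtain m' x' y' where m': "m' \<in> \<M>" "snd m' = x' @ y'"
    "C' = (path_end Q (fst m', x'), map Inl y' @ Inr m' # map Inl x')"
    using assms(2) by (rule cyclesE)
  show ?thesis
  proof (cases y)
    case Nil
    with m m' assms(3) show ?thesis
      by (cases y') auto
  next
    case (Cons a z)
    with m m' assms(3) obtain z' where "y' = a # z'"
      by (cases y') auto
    with Cons m m' maximal_path_unique[of m m' x a z x' z'] show ?thesis
      by simp
  qed
qed

text \<open>A maximal path through \<open>p\<close> is closed up by its new arrow and rotated until
  \<open>p\<close> stands in front.\<close>

lemma cycle_extends_nonzero_path:
  assumes "p \<in> nonzero_paths"
  obtains w where "(fst p, map Inl (snd p) @ w) \<in> \<S>"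
proof -
  obtain m x y where "m \<in> \<M>" "snd m = x @ snd p @ y" "path_end Q (fst m, x) = fst p"
    using assms by (rule subpath_of_maximal_path)
  then have "(fst p, map Inl (snd p) @ map Inl y @ Inr m # map Inl x) \<in> \<S>"
    unfolding cycles_iff by (intro bexI[of _ m] exI[of _ x] exI[of _ "snd p @ y"]) auto
  with that show ?thesis .
qed

lemma arrow_nonzero: "a \<in> arcs Q \<Longrightarrow> (tail Q a, [a]) \<in> nonzero_paths"
  by (simp add: nonzero_paths_iff)

lemma cycle_starting_with:
  assumes "a \<in> arcs Qs"
  obtains w where "(tail Qs a, a # w) \<in> \<S>"
proof (cases a)
  case (Inl b)
  then have "(tail Q b, [b]) \<in> nonzero_paths"
    using assms arrow_nonzero by auto
  then obtain w where "(tail Q b, Inl b # w) \<in> \<S>"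
    by (rule cycle_extends_nonzero_path) simp
  with that Inl show ?thesis
    by simp
next
  case (Inr m)
  then have "(path_end Q m, Inr m # map Inl (snd m)) \<in> \<S>"
    using assms unfolding cycles_iff by (intro bexI[of _ m] exI[of _ "snd m"] exI[of _ "[]"]) auto
  with that Inr show ?thesis
    by simp
qed

text \<open>The only new arrow of the cycle comes after \<open>y\<close>. An initial run of old
  arrows therefore stays inside \<open>y\<close>, a final segment of a maximal path, and the new
  arrow is left for \<open>w\<close>.\<close>

lemma old_prefix_of_cycle:
  assumes "(u, map Inl p @ w) \<in> \<S>"
  shows "(u, p) \<in> nonzero_paths" "\<exists>a\<in>set w. \<not> isl a"
proof -
  obtain m x y where "m \<in> \<M>" "snd m = x @ y"
    "(u, map Inl p @ w) = (path_end Q (fst m, x), map Inl y @ Inr m # map Inl x)"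
    using assms by (rule cyclesE)
  then have m: "m \<in> \<M>" "snd m = x @ y" "u = path_end Q (fst m, x)"
    "map Inl p @ w = map Inl y @ Inr m # map Inl x"
    by simp_all
  have "(fst m, snd m) \<in> nonzero_paths"
    using m(1) by (simp add: maximal_paths_iff)
  then have y: "(u, y) \<in> nonzero_paths"
    using nonzero_paths_append(2) unfolding m(2,3) by blast
  \<comment> \<open>Comparing the two factorizations, \<open>map Inl p\<close> cannot reach past
    \<open>map Inl y\<close>, since it would then contain the new arrow.\<close>
  obtain z where z: "w = z @ Inr m # map Inl x" "map Inl y = map Inl p @ z"
  proof -
    have False if "map Inl p = map Inl y @ Inr m # z" for z
    proof -
      have "Inr m \<in> set (map Inl p)"
        unfolding that by simp
      then show False
        by auto
    qed
    with m(4) that show ?thesis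
      by (auto simp: append_eq_append_conv2 append_eq_Cons_conv)
  qed
  then obtain y' where "y = p @ y'"
    by (auto simp: map_eq_append_conv inj_map_eq_map)
  then show "(u, p) \<in> nonzero_paths"
    using y nonzero_paths_append by simp
  show "\<exists>a\<in>set w. \<not> isl a"
    using z(1) by simp
qed

text \<open>The pairs of arrows that Type 3 leaves alone. In a cycle of length one the arrow is not
  its own successor, so its square is of Type 3.\<close>

definition cycle_succ :: "'a + ('v, 'a) qpath \<Rightarrow> 'a + ('v, 'a) qpath \<Rightarrow> bool" where
  "cycle_succ a b \<longleftrightarrow> (\<exists>C\<in>\<S>. sublist [a, b] (snd C))"

lemma cycle_succE:
  assumes "cycle_succ a b"
  obtains u w where "(u, a # b # w) \<in> \<S>"
proof -
  obtain u x y where "(u, x @ [a, b] @ y) \<in> \<S>"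
    using assms by (auto simp: cycle_succ_def sublist_def)
  then have "(path_end Qs (u, x), ([a, b] @ y) @ x) \<in> \<S>"
    by (rule cycle_rotate)
  with that show ?thesis
    by simp
qed

lemma cycle_succ_unique: "cycle_succ a b \<Longrightarrow> cycle_succ a c \<Longrightarrow> b = c"
  by (elim cycle_succE) (auto dest: cycle_unique)

lemma successively_cycle_succ: "C \<in> \<S> \<Longrightarrow> successively cycle_succ (snd C)"
  by (rule ccontr) (auto simp: not_successively_iff cycle_succ_def sublist_def)

text \<open>\<open>cycle_succ\<close> is functional, so a path without a Type 3 pair follows the
  unique cycle that starts with its first arrow. It either stops within that cycle or runs on and
  contains a Type 2 relation.\<close>

lemma star_path_cases:
  assumes "(u, a # s) \<in> paths Qs"
  obtains (zero) x b c y where "a # s = x @ [b, c] @ y" "\<not> cycle_succ b c"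
    | (sub) y where "(u, a # s @ y) \<in> \<S>"
    | (long) C y where "C \<in> \<S>" "fst C = u" "a # s = snd C @ [hd (snd C)] @ y"
proof (cases "successively cycle_succ (a # s)")
  case False
  then show ?thesis
    using zero by (auto simp: not_successively_iff)
next
  case True
  obtain r where r: "(u, a # r) \<in> \<S>"
    using assms cycle_starting_with[of a] by (auto simp del: star_quiver_simps)
  then have "prefix s r \<or> prefix r s"
    using True successively_cycle_succ[OF r]
    by (intro successively_prefix_cases[of cycle_succ a]) (auto dest: cycle_succ_unique)
  then consider y where "r = s @ y" | b y where "s = r @ b # y"
    by (metis append_Nil2 list.exhaust prefix_def)
  then show ?thesis
  proof cases
    case 1
    with r sub show ?thesis
      by simp
  next
    case 2
    \<comment> \<open>Rotated to start at its last arrow \<open>l\<close>, the cycle shows that the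
      only successor of \<open>l\<close> is the first arrow \<open>a\<close>. For a cycle of length
      one \<open>l\<close> has no successor and the case is void.\<close>
    define l where "l = last (a # r)"
    have "cycle_succ l b"
      using True unfolding 2 l_def
      by (auto simp: successively_append_iff successively_Cons split: if_splits)
    then obtain v w where "(v, l # b # w) \<in> \<S>"
      by (rule cycle_succE)
    moreover have "butlast (a # r) @ [l] = a # r"
      unfolding l_def by (rule append_butlast_last_id) simp
    with r have "(u, butlast (a # r) @ [l]) \<in> \<S>"
      by (simp only:)
    from cycle_rotate[OF this] have "(path_end Qs (u, butlast (a # r)), l # butlast (a # r)) \<in> \<S>"
      by simp
    ultimately have "b # w = butlast (a # r)"
      by (auto dest: cycle_unique)
    then have "b = a"
      by (cases r) auto
    with 2 r long[of "(u, a # r)" y] show ?thesis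
      by simp
  qed
qed

end

section \<open>The symmetrizing form of \<open>A\<^sup>*\<close>\<close>

context almost_gentle_algebra
begin

definition incl :: "(('v, 'a) qpath \<Rightarrow> 'k) \<Rightarrow> ('v, 'a + ('v, 'a) qpath) qpath \<Rightarrow> 'k" where
  "incl f = (\<lambda>(u, w). if \<forall>a\<in>set w. isl a then f (u, map projl w) else 0)"

text \<open>The retraction of \<open>KQs\<close> onto \<open>KQ\<close> that kills all new arrows:
  it is multiplicative and has \<open>incl\<close> as a section.\<close>

definition restr :: "(('v, 'a + ('v, 'a) qpath) qpath \<Rightarrow> 'k) \<Rightarrow> ('v, 'a) qpath \<Rightarrow> 'k" where
  "restr F = (\<lambda>(u, p). F (u, map Inl p))"

definition trace :: "(('v, 'a + ('v, 'a) qpath) qpath \<Rightarrow> 'k) \<Rightarrow> 'k" where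
  "trace F = (\<Sum>C\<in>\<S>. F C)"

definition pairing ::
    "(('v, 'a) qpath \<Rightarrow> 'k) \<Rightarrow> (('v, 'a + ('v, 'a) qpath) qpath \<Rightarrow> 'k) \<Rightarrow> 'k" where
  "pairing x F = trace (incl x \<otimes>\<^bsub>KQs\<^esub> F)"

lemma all_isl_iff: "(\<forall>a\<in>set w. isl a) \<longleftrightarrow> (\<exists>p. w = map Inl p)"
proof
  assume "\<forall>a\<in>set w. isl a"
  then have "w = map Inl (map projl w)"
    by (induction w) auto
  then show "\<exists>p. w = map Inl p" ..
qed auto

lemma restr_apply: "restr F (u, p) = F (u, map Inl p)"
  by (simp add: restr_def)

lemma incl_map_Inl [simp]: "incl f (u, map Inl p) = f (u, p)"
  by (simp add: incl_def comp_def)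

lemma incl_nonzeroE:
  assumes "incl f (u, w) \<noteq> 0"
  obtains p where "w = map Inl p" "f (u, p) \<noteq> 0"
proof -
  have "\<forall>a\<in>set w. isl a"
    using assms by (auto simp: incl_def split: if_splits)
  then obtain p where "w = map Inl p"
    by (auto simp: all_isl_iff)
  with assms that show ?thesis
    by simp
qed

lemma restr_incl [simp]: "restr (incl f) = f"
  by (auto simp: restr_def)

lemma incl_of_path: "incl (of_path (u, p)) = of_path (u, map Inl p)"
proof (rule ext, clarify)
  fix v w
  show "incl (of_path (u, p)) (v, w) = of_path (u, map Inl p) (v, w)"
  proof (cases "\<exists>q. w = map Inl q")
    case True
    then show ?thesis
      by (auto simp: of_path_def inj_map_eq_map)
  next
    case False
    then have "incl (of_path (u, p)) (v, w) = 0"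
      by (meson incl_nonzeroE)
    with False show ?thesis
      by (auto simp: of_path_def)
  qed
qed

lemma restr_add: "restr (F \<oplus>\<^bsub>KQs\<^esub> G) = restr F \<oplus>\<^bsub>KQ\<^esub> restr G"
  by (auto simp: restr_def path_algebra_simps(4))

lemma restr_smult: "restr (c \<odot>\<^bsub>KQs\<^esub> F) = c \<odot>\<^bsub>KQ\<^esub> restr F"
  by (auto simp: restr_def path_algebra_simps(5))

lemma restr_one: "restr \<one>\<^bsub>KQs\<^esub> = \<one>\<^bsub>KQ\<^esub>"
  by (auto simp: restr_def path_algebra_simps(2))

lemma restr_mult: "restr (F \<otimes>\<^bsub>KQs\<^esub> G) = restr F \<otimes>\<^bsub>KQ\<^esub> restr G"
  by (rule ext, clarify) (simp add: restr_apply path_mult take_map drop_map)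

lemma restr_carrier:
  assumes "F \<in> carrier KQs"
  shows "restr F \<in> carrier KQ"
proof -
  have "{p. restr F p \<noteq> 0} \<subseteq> (\<lambda>(u, w). (u, map projl w)) ` {q. F q \<noteq> 0}"
    by (force simp: restr_apply comp_def)
  then have "finite {p. restr F p \<noteq> 0}"
    by (rule finite_subset) (use assms in \<open>simp add: path_algebra_simps(1)\<close>)
  moreover have "(u, p) \<in> paths Q" if "restr F (u, p) \<noteq> 0" for u p
    using assms that by (auto simp: path_algebra_simps(1) restr_apply simp flip: paths_map_Inl)
  ultimately show ?thesis
    by (auto simp: path_algebra_simps(1))
qed

lemma incl_add: "incl (f \<oplus>\<^bsub>KQ\<^esub> g) = incl f \<oplus>\<^bsub>KQs\<^esub> incl g"
  by (auto simp: incl_def path_algebra_simps(4))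

lemma incl_smult: "incl (c \<odot>\<^bsub>KQ\<^esub> f) = c \<odot>\<^bsub>KQs\<^esub> incl f"
  by (auto simp: incl_def path_algebra_simps(5))

lemma incl_mult: "incl (f \<otimes>\<^bsub>KQ\<^esub> g) = incl f \<otimes>\<^bsub>KQs\<^esub> incl g"
proof (rule ext, clarify)
  fix u w
  show "incl (f \<otimes>\<^bsub>KQ\<^esub> g) (u, w) = (incl f \<otimes>\<^bsub>KQs\<^esub> incl g) (u, w)"
  proof (cases "\<exists>p. w = map Inl p")
    case True
    then show ?thesis
      by (auto simp: path_mult take_map drop_map)
  next
    case False
    have "(incl f \<otimes>\<^bsub>KQs\<^esub> incl g) (u, w) = 0"
    proof (rule ccontr)
      assume "(incl f \<otimes>\<^bsub>KQs\<^esub> incl g) (u, w) \<noteq> 0"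
      then obtain i where "incl f (u, take i w) \<noteq> 0" "incl g (path_end Qs (u, take i w), drop i w) \<noteq> 0"
        by (rule path_mult_nonzeroE)
      then obtain p q where "take i w = map Inl p" "drop i w = map Inl q"
        by (metis incl_nonzeroE)
      then have "w = map Inl (p @ q)"
        by (metis append_take_drop_id map_append)
      with False show False
        by blast
    qed
    moreover have "incl (f \<otimes>\<^bsub>KQ\<^esub> g) (u, w) = 0"
      using False by (meson incl_nonzeroE)
    ultimately show ?thesis
      by simp
  qed
qed

lemma incl_carrier:
  assumes "f \<in> carrier KQ"
  shows "incl f \<in> carrier KQs"
proof -
  have *: "q \<in> (\<lambda>(u, p). (u, map Inl p)) ` {p. f p \<noteq> 0}" if "incl f q \<noteq> 0" for q
    using that by (cases q) (force elim: incl_nonzeroE)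
  then have "{q. incl f q \<noteq> 0} \<subseteq> (\<lambda>(u, p). (u, map Inl p)) ` {p. f p \<noteq> 0}"
    by blast
  then have "finite {q. incl f q \<noteq> 0}"
    by (rule finite_subset) (use assms in \<open>simp add: path_algebra_simps(1)\<close>)
  moreover have "{q. incl f q \<noteq> 0} \<subseteq> paths Qs"
    using * assms by (fastforce simp: path_algebra_simps(1))
  ultimately show ?thesis
    by (simp add: path_algebra_simps(1))
qed

section \<open>The trace and the pairing\<close>

lemma trace_add: "trace (F \<oplus>\<^bsub>KQs\<^esub> G) = trace F + trace G"
  by (simp add: trace_def path_algebra_simps(4) sum.distrib)

lemma trace_smult: "trace (c \<odot>\<^bsub>KQs\<^esub> F) = c * trace F"
  by (simp add: trace_def path_algebra_simps(5) sum_distrib_left)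

lemma trace_incl: "trace (incl f) = 0"
  unfolding trace_def
proof (rule sum.neutral, rule ballI)
  fix C assume C: "C \<in> \<S>"
  show "incl f C = 0"
  proof (rule ccontr)
    assume "incl f C \<noteq> 0"
    then obtain p where "snd C = map Inl p"
      by (cases C) (auto elim: incl_nonzeroE)
    then show False
      using cycle_one_new_arrow[OF C] by (simp add: comp_def)
  qed
qed

text \<open>The terms of the trace of a product are indexed by a cycle and a cut of it. Rotating the
  cycle at the cut interchanges the two pieces, and this is an involution on the index set because
  cycles are closed.\<close>

lemma trace_commute: "trace (F \<otimes>\<^bsub>KQs\<^esub> G) = trace (G \<otimes>\<^bsub>KQs\<^esub> F)"
proof -
  let ?X = "Sigma \<S> (\<lambda>C. {..length (snd C)})"
  let ?t = "\<lambda>F G (C, i). F (fst C, take i (snd C)) *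
              G (path_end Qs (fst C, take i (snd C)), drop i (snd C)) :: 'k"
  let ?r = "\<lambda>(C, i). ((path_end Qs (fst C, take i (snd C)), drop i (snd C) @ take i (snd C)),
              length (snd C) - i)"
  have *: "trace (F \<otimes>\<^bsub>KQs\<^esub> G) = sum (?t F G) ?X" for F G
  proof -
    have "trace (F \<otimes>\<^bsub>KQs\<^esub> G) = (\<Sum>C\<in>\<S>. \<Sum>i\<le>length (snd C). ?t F G (C, i))"
      unfolding trace_def
      by (intro sum.cong refl) (metis (no_types, lifting) case_prod_conv path_mult prod.collapse sum.cong)
    then show ?thesis
      by (simp add: sum.Sigma finite_cycles)
  qed
  have closed: "path_end Qs (u, w) = u" if "(u, w) \<in> \<S>" for u w
    using cycle_closed[OF that] by simp
  have r: "?r z \<in> ?X" "?r (?r z) = z" "?t G F (?r z) = ?t F G z" if mem: "z \<in> ?X" for z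
  proof -
    obtain u w i where z: "z = ((u, w), i)" "(u, w) \<in> \<S>" "i \<le> length w"
      using mem by (cases z) auto
    then show "?r z \<in> ?X"
      using cycle_rotate[of u "take i w" "drop i w"] by simp
    show "?r (?r z) = z" "?t G F (?r z) = ?t F G z"
      using z closed path_end_take_drop[of Qs u i w] by (simp_all add: mult.commute)
  qed
  show ?thesis
    unfolding * by (rule sum.reindex_bij_witness[of _ ?r ?r]) (use r in blast)+
qed

text \<open>A nonzero term would cut a cycle so that the factors of \<open>F\<close> and of
  \<open>G\<close> each hold a new arrow, but a cycle holds only one.\<close>

lemma trace_mult_new:
  assumes F: "\<And>u p. F (u, map Inl p) = 0" and G: "\<And>u p. G (u, map Inl p) = 0"
  shows "trace (X \<otimes>\<^bsub>KQs\<^esub> (F \<otimes>\<^bsub>KQs\<^esub> G)) = 0"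
  unfolding trace_def
proof (rule sum.neutral, rule ballI, rule ccontr)
  fix C assume C: "C \<in> \<S>" "(X \<otimes>\<^bsub>KQs\<^esub> (F \<otimes>\<^bsub>KQs\<^esub> G)) C \<noteq> 0"
  obtain u w where uw: "C = (u, w)"
    by (cases C)
  obtain i where "(F \<otimes>\<^bsub>KQs\<^esub> G) (path_end Qs (u, take i w), drop i w) \<noteq> 0"
    using C(2) unfolding uw by (rule path_mult_nonzeroE)
  then obtain j v v' where "F (v, take j (drop i w)) \<noteq> 0" "G (v', drop j (drop i w)) \<noteq> 0"
    by (rule path_mult_nonzeroE)
  then have "filter (\<lambda>a. \<not> isl a) (take j (drop i w)) \<noteq> []" "filter (\<lambda>a. \<not> isl a) (drop j (drop i w)) \<noteq> []"
    using F G all_isl_iff by (metis (mono_tags, lifting) filter_empty_conv)+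
  moreover have "length (filter (\<lambda>a. \<not> isl a) (take i w @ take j (drop i w) @ drop j (drop i w))) = 1"
    using cycle_one_new_arrow[OF C(1)] unfolding append_take_drop_id uw by simp
  ultimately show False
    unfolding filter_append length_append length_greater_0_conv [symmetric] by linarith
qed

lemma pairing_add_left: "pairing (x \<oplus>\<^bsub>KQ\<^esub> y) F = pairing x F + pairing y F"
  by (simp add: pairing_def incl_add path_mult_add_left trace_add)

lemma pairing_add_right: "pairing x (F \<oplus>\<^bsub>KQs\<^esub> G) = pairing x F + pairing x G"
  by (simp add: pairing_def path_mult_add_right trace_add)

lemma pairing_smult_left: "pairing (c \<odot>\<^bsub>KQ\<^esub> x) F = c * pairing x F"
  by (simp add: pairing_def incl_smult path_mult_smult_left trace_smult)

lemma pairing_smult_right: "pairing x (c \<odot>\<^bsub>KQs\<^esub> F) = c * pairing x F"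
  by (simp add: pairing_def path_mult_smult_right trace_smult)

lemma pairing_incl: "pairing x (incl f) = 0"
  by (simp add: pairing_def trace_incl flip: incl_mult)

text \<open>
  Each cycle contains exactly one new arrow, so only the terms with exactly one factor
  that contains new arrows survive under the trace.
\<close>

lemma pairing_mult:
  "pairing x (F \<otimes>\<^bsub>KQs\<^esub> G) = pairing (x \<otimes>\<^bsub>KQ\<^esub> restr F) G + pairing (restr G \<otimes>\<^bsub>KQ\<^esub> x) F"
proof -
  define F' G' where "F' = (\<lambda>p. F p - incl (restr F) p)" and "G' = (\<lambda>p. G p - incl (restr G) p)"
  have F: "F = incl (restr F) \<oplus>\<^bsub>KQs\<^esub> F'" and G: "G = incl (restr G) \<oplus>\<^bsub>KQs\<^esub> G'"
    by (simp_all add: F'_def G'_def path_algebra_simps(4))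
  have new: "pairing x (F' \<otimes>\<^bsub>KQs\<^esub> G') = 0"
    unfolding pairing_def by (rule trace_mult_new) (simp_all add: F'_def G'_def restr_apply)
  have "pairing x (F \<otimes>\<^bsub>KQs\<^esub> G) =
      pairing x (incl (restr F) \<otimes>\<^bsub>KQs\<^esub> G) + pairing x (F' \<otimes>\<^bsub>KQs\<^esub> G)"
    by (subst F) (simp add: path_mult_add_left pairing_add_right)
  also have "pairing x (F' \<otimes>\<^bsub>KQs\<^esub> G) = pairing x (F' \<otimes>\<^bsub>KQs\<^esub> incl (restr G))"
    by (subst G) (simp add: path_mult_add_right pairing_add_right new)
  also have "\<dots> = pairing x (F \<otimes>\<^bsub>KQs\<^esub> incl (restr G))"
    by (subst F) (simp add: path_mult_add_left pairing_add_right pairing_incl flip: incl_mult)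
  also have "\<dots> = pairing (restr G \<otimes>\<^bsub>KQ\<^esub> x) F"
    using trace_commute[of "incl x \<otimes>\<^bsub>KQs\<^esub> F" "incl (restr G)"]
    by (simp add: pairing_def incl_mult path_mult_assoc)
  also have "pairing x (incl (restr F) \<otimes>\<^bsub>KQs\<^esub> G) = pairing (x \<otimes>\<^bsub>KQ\<^esub> restr F) G"
    by (simp add: pairing_def incl_mult path_mult_assoc)
  finally show ?thesis .
qed

text \<open>A nonzero term would start a cycle with an old path in the support of \<open>x\<close>;
  such a path is nonzero, and \<open>x\<close> vanishes there. Hence the pairing descends to
  \<open>A\<close> in its first argument.\<close>

lemma pairing_I:
  assumes "x \<in> I"
  shows "pairing x F = 0"
  unfolding pairing_def trace_def
proof (rule sum.neutral, rule ballI, rule ccontr)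
  fix C assume C: "C \<in> \<S>" "(incl x \<otimes>\<^bsub>KQs\<^esub> F) C \<noteq> 0"
  obtain u w where uw: "C = (u, w)"
    by (cases C)
  obtain i where "incl x (u, take i w) \<noteq> 0"
    using C(2) unfolding uw by (rule path_mult_nonzeroE)
  then obtain p where p: "take i w = map Inl p" "x (u, p) \<noteq> 0"
    by (rule incl_nonzeroE)
  have "(u, map Inl p @ drop i w) \<in> \<S>"
    using C(1) by (simp add: uw flip: p(1))
  then have "(u, p) \<in> nonzero_paths"
    by (rule old_prefix_of_cycle)
  with assms p(2) show False
    by (simp add: mem_I_iff)
qed

text \<open>The sum runs over the complements of \<open>p\<close> in cycles. A nontrivial
  \<open>p\<close> has at most one, by \<open>cycle_unique\<close>; a trivial \<open>p\<close> has
  all cycles at its vertex.\<close>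

lemma pairing_of_path_left:
  "pairing (of_path p) F =
     (\<Sum>w | (fst p, map Inl (snd p) @ w) \<in> \<S>. F (path_end Q p, w))"
proof -
  obtain u b where p: "p = (u, b)"
    by (cases p)
  let ?b = "map Inl b" and ?W = "{w. (u, map Inl b @ w) \<in> \<S>}"
  let ?T = "{C \<in> \<S>. fst C = u \<and> prefix ?b (snd C)}"
  have "pairing (of_path p) F =
      (\<Sum>C\<in>\<S>. if fst C = u \<and> prefix ?b (snd C)
         then F (path_end Q (u, b), drop (length b) (snd C)) else 0)"
    unfolding pairing_def trace_def p incl_of_path
    by (rule sum.cong) (auto simp: path_mult_of_path_left)
  also have "\<dots> = (\<Sum>C\<in>?T. F (path_end Q (u, b), drop (length b) (snd C)))"
    by (simp add: sum.inter_filter finite_cycles)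
  also have "\<dots> = (\<Sum>w\<in>?W. F (path_end Q (u, b), w))"
    by (rule sum.reindex_bij_witness[of _ "\<lambda>w. (u, ?b @ w)" "\<lambda>C. drop (length b) (snd C)"])
      (auto simp: prefix_def)
  finally show ?thesis
    by (simp add: p)
qed

lemma pairing_of_path_eq_0:
  assumes "\<And>C. C \<in> \<S> \<Longrightarrow> \<not> suffix (snd q) (snd C)"
  shows "pairing x (of_path q) = 0"
  unfolding pairing_def trace_def
proof (rule sum.neutral, rule ballI)
  fix C assume "C \<in> \<S>"
  then show "(incl x \<otimes>\<^bsub>KQs\<^esub> of_path q) C = 0"
    using assms[of C] by (cases C) (auto simp: path_mult_of_path_right suffix_def)
qed

text \<open>If a cycle \<open>D\<close> ends with \<open>C\<close>, rotating \<open>D\<close> puts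
  \<open>C\<close> in front, and uniqueness leaves no further arrows. The value depends only on the
  vertex of \<open>C\<close>, which is why Type 1 relations pair to zero.\<close>

lemma pairing_of_cycle:
  assumes "C \<in> \<S>"
  shows "pairing x (of_path C) = x (fst C, [])"
proof -
  obtain v c where C: "C = (v, c)"
    by (cases C)
  have "(incl x \<otimes>\<^bsub>KQs\<^esub> of_path C) D = (if D = C then x (v, []) else 0)" if "D \<in> \<S>" for D
  proof -
    obtain u w where D: "D = (u, w)"
      by (cases D)
    have "p = [] \<and> D = C" if "w = p @ c" "path_end Qs (u, p) = v" for p
    proof -
      have "(v, c @ p) \<in> \<S>"
        using \<open>D \<in> \<S>\<close> cycle_rotate[of u p c] that D by simp
      then have "(v, c @ p) = C"
        using assms cycle_nonempty[OF assms] by (intro cycle_unique) (auto simp: C)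
      then have "p = []"
        by (simp add: C)
      with that show ?thesis
        by (simp add: C D)
    qed
    moreover have "incl x (v, []) = x (v, [])"
      using incl_map_Inl[of x v "[]"] by simp
    ultimately show ?thesis
      unfolding D path_mult_of_path_right by (auto simp: C)
  qed
  then show ?thesis
    unfolding pairing_def trace_def using assms finite_cycles by (simp add: C)
qed

end

section \<open>The isomorphism with the trivial extension\<close>

context fin_digraph
begin

lemma quot_algebra_simps:
  "carrier (quot_algebra (path_algebra G) J) = (\<lambda>x. J +>\<^bsub>path_algebra G\<^esub> x) ` carrier (path_algebra G)"
  "\<one>\<^bsub>quot_algebra (path_algebra G) J\<^esub> = J +>\<^bsub>path_algebra G\<^esub> \<one>\<^bsub>path_algebra G\<^esub>"
  "\<zero>\<^bsub>quot_algebra (path_algebra G) J\<^esub> = J"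
  by (auto simp: quot_algebra_def FactRing_def A_RCOSETS_def')

lemma quot_algebra_mult:
  assumes "ideal J (path_algebra G)" "x \<in> carrier (path_algebra G)" "y \<in> carrier (path_algebra G)"
  shows "(J +>\<^bsub>path_algebra G\<^esub> x) \<otimes>\<^bsub>quot_algebra (path_algebra G) J\<^esub> (J +>\<^bsub>path_algebra G\<^esub> y) =
           J +>\<^bsub>path_algebra G\<^esub> (x \<otimes>\<^bsub>path_algebra G\<^esub> y)"
  using ideal.rcoset_mult_add[OF assms] by (simp add: quot_algebra_def FactRing_def)

lemma quot_algebra_add:
  assumes "ideal J (path_algebra G)" "x \<in> carrier (path_algebra G)" "y \<in> carrier (path_algebra G)"
  shows "(J +>\<^bsub>path_algebra G\<^esub> x) \<oplus>\<^bsub>quot_algebra (path_algebra G) J\<^esub> (J +>\<^bsub>path_algebra G\<^esub> y) =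
           J +>\<^bsub>path_algebra G\<^esub> (x \<oplus>\<^bsub>path_algebra G\<^esub> y)"
  using ideal.a_rcos_sum[OF assms] by (simp add: quot_algebra_def FactRing_def)

lemma coset_eq_iff:
  fixes x y :: "'a \<times> 'b list \<Rightarrow> 'k::field"
  assumes "ideal J (path_algebra G)" "x \<in> carrier (path_algebra G)" "y \<in> carrier (path_algebra G)"
  shows "J +>\<^bsub>path_algebra G\<^esub> x = J +>\<^bsub>path_algebra G\<^esub> y \<longleftrightarrow> (\<lambda>p. x p - y p) \<in> J"
  using ring.quotient_eq_iff_same_a_r_cos[OF path_algebra_ring assms] minus_path_algebra[OF assms(2,3)]
  by simp

lemma coset_repr:
  fixes x y :: "'a \<times> 'b list \<Rightarrow> 'k::field"
  assumes "ideal J (path_algebra G)" "x \<in> carrier (path_algebra G)" "y \<in> J +>\<^bsub>path_algebra G\<^esub> x"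
  shows "y \<in> carrier (path_algebra G)" "(\<lambda>p. y p - x p) \<in> J"
proof -
  interpret ideal J "path_algebra G" by fact
  show y: "y \<in> carrier (path_algebra G)"
    using assms(2,3) a_r_coset_subset_G a_subset by blast
  have "J +>\<^bsub>path_algebra G\<^esub> y = J +>\<^bsub>path_algebra G\<^esub> x"
    using a_repr_independence[OF assms(3,2) a_subgroup] by simp
  then show "(\<lambda>p. y p - x p) \<in> J"
    using coset_eq_iff[OF assms(1) y assms(2)] by simp
qed

text \<open>The scalar multiple of a coset is defined as a union over all representatives. They
  differ by elements of \<open>J\<close>, so the cosets in the union coincide, and the union is over
  a nonempty set.\<close>

lemma quot_algebra_smult:
  fixes x :: "'a \<times> 'b list \<Rightarrow> 'k::field"
  assumes J: "ideal J (path_algebra G)" and x: "x \<in> carrier (path_algebra G)"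
  shows "c \<odot>\<^bsub>quot_algebra (path_algebra G) J\<^esub> (J +>\<^bsub>path_algebra G\<^esub> x) =
           J +>\<^bsub>path_algebra G\<^esub> (c \<odot>\<^bsub>path_algebra G\<^esub> x)"
proof -
  interpret ideal J "path_algebra G" by (fact J)
  have "J +>\<^bsub>path_algebra G\<^esub> (c \<odot>\<^bsub>path_algebra G\<^esub> y) = J +>\<^bsub>path_algebra G\<^esub> (c \<odot>\<^bsub>path_algebra G\<^esub> x)"
    if "y \<in> J +>\<^bsub>path_algebra G\<^esub> x" for y
  proof -
    have "c \<odot>\<^bsub>path_algebra G\<^esub> (\<lambda>p. y p - x p) \<in> J"
      using coset_repr[OF J x that] by (intro ideal_smult_closed[OF J])
    then have *: "(\<lambda>p. (c \<odot>\<^bsub>path_algebra G\<^esub> y) p - (c \<odot>\<^bsub>path_algebra G\<^esub> x) p) \<in> J"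
      by (simp add: path_algebra_simps(5) right_diff_distrib)
    show ?thesis
      using * by (rule coset_eq_iff[OF J, THEN iffD2, rotated 2])
        (intro smult_carrier coset_repr(1)[OF J x that] x)+
  qed
  then have "(\<Union>y\<in>J +>\<^bsub>path_algebra G\<^esub> x. J +>\<^bsub>path_algebra G\<^esub> (c \<odot>\<^bsub>path_algebra G\<^esub> y)) =
      (\<Union>y\<in>J +>\<^bsub>path_algebra G\<^esub> x. J +>\<^bsub>path_algebra G\<^esub> (c \<odot>\<^bsub>path_algebra G\<^esub> x))"
    by (intro SUP_cong refl)
  also have "\<dots> = J +>\<^bsub>path_algebra G\<^esub> (c \<odot>\<^bsub>path_algebra G\<^esub> x)"
    using a_rcos_self[OF x] by (metis UN_constant empty_iff)
  finally show ?thesis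
    by (simp add: quot_algebra_def)
qed

end

section \<open>The surjection onto the trivial extension\<close>

context almost_gentle_algebra
begin

abbreviation A :: "('k, (('v, 'a) qpath \<Rightarrow> 'k) set) module" where
  "A \<equiv> quot_algebra KQ I"

abbreviation coset :: "(('v, 'a) qpath \<Rightarrow> 'k) \<Rightarrow> (('v, 'a) qpath \<Rightarrow> 'k) set" where
  "coset x \<equiv> I +>\<^bsub>KQ\<^esub> x"

lemmas A_simps = quot_algebra_simps[of I]
lemmas A_mult = quot_algebra_mult[OF ideal_I]
lemmas A_add = quot_algebra_add[OF ideal_I]
lemmas A_smult = quot_algebra_smult[OF ideal_I]

text \<open>The pairing is evaluated at an arbitrary representative; \<open>functional_coset\<close>
  shows that the choice is immaterial. The restriction to the carrier meets the convention of
  \<open>dual_space\<close>.\<close>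

definition functional ::
    "(('v, 'a + ('v, 'a) qpath) qpath \<Rightarrow> 'k) \<Rightarrow> (('v, 'a) qpath \<Rightarrow> 'k) set \<Rightarrow> 'k" where
  "functional F = (\<lambda>X\<in>carrier A. pairing (SOME x. x \<in> X) F)"

definition to_trivial_extension ::
    "(('v, 'a + ('v, 'a) qpath) qpath \<Rightarrow> 'k) \<Rightarrow>
     (('v, 'a) qpath \<Rightarrow> 'k) set \<times> ((('v, 'a) qpath \<Rightarrow> 'k) set \<Rightarrow> 'k)" where
  "to_trivial_extension F = (coset (restr F), functional F)"

lemma coset_carrier: "x \<in> carrier KQ \<Longrightarrow> coset x \<in> carrier A"
  by (simp add: A_simps)

lemma functional_coset:
  assumes x: "x \<in> carrier KQ"
  shows "functional F (coset x) = pairing x F"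
proof -
  define y where "y = (SOME y. y \<in> coset x)"
  have "y \<in> coset x"
    unfolding y_def using I.a_rcos_self[OF x] by (rule someI [of "\<lambda>y. y \<in> coset x"])
  then have *: "(\<lambda>p. y p - x p) \<in> I"
    by (rule coset_repr[OF ideal_I x])
  have "pairing y F = pairing ((\<lambda>p. y p - x p) \<oplus>\<^bsub>KQ\<^esub> x) F"
    by (simp add: path_algebra_simps(4))
  then have "pairing y F = pairing x F"
    by (simp only: pairing_add_left pairing_I[OF *] add_0)
  then show ?thesis
    using coset_carrier[OF x] by (simp add: functional_def y_def)
qed

lemma functional_dual: "functional F \<in> dual_space A"
  unfolding dual_space_def
proof (intro CollectI conjI ballI allI)
  show "functional F \<in> extensional (carrier A)"
    by (simp add: functional_def)
next
  fix X Y assume "X \<in> carrier A" "Y \<in> carrier A"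
  then show "functional F (X \<oplus>\<^bsub>A\<^esub> Y) = functional F X + functional F Y"
    by (auto simp: A_simps A_add functional_coset pairing_add_left)
next
  fix c X assume "X \<in> carrier A"
  then show "functional F (c \<odot>\<^bsub>A\<^esub> X) = c * functional F X"
    by (auto simp: A_simps A_smult functional_coset pairing_smult_left smult_carrier)
qed

lemma extensional_carrier_eqI:
  assumes "f \<in> extensional (carrier A)" "g \<in> extensional (carrier A)"
    "\<And>x. x \<in> carrier KQ \<Longrightarrow> f (coset x) = g (coset x)"
  shows "f = g"
  using assms by (intro extensionalityI) (auto simp: A_simps)

lemma functional_add: "functional (F \<oplus>\<^bsub>KQs\<^esub> G) = dual_add A (functional F) (functional G)"
  by (rule extensional_carrier_eqI)
    (use functional_dual in \<open>auto simp: dual_space_def dual_add_def coset_carrier functional_coset pairing_add_right\<close>)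

lemma functional_smult: "functional (c \<odot>\<^bsub>KQs\<^esub> F) = (\<lambda>X\<in>carrier A. c * functional F X)"
  by (rule extensional_carrier_eqI)
    (use functional_dual in \<open>auto simp: dual_space_def coset_carrier functional_coset pairing_smult_right\<close>)

lemma functional_eq_zero_iff:
  "functional F = (\<lambda>X\<in>carrier A. 0) \<longleftrightarrow> (\<forall>x\<in>carrier KQ. pairing x F = 0)"
proof
  assume F: "functional F = (\<lambda>X\<in>carrier A. 0)"
  show "\<forall>x\<in>carrier KQ. pairing x F = 0"
  proof
    fix x assume "x \<in> carrier KQ"
    then show "pairing x F = 0"
      using fun_cong[OF F, of "coset x"] by (simp add: functional_coset coset_carrier)
  qed
next
  assume "\<forall>x\<in>carrier KQ. pairing x F = 0"
  then show "functional F = (\<lambda>X\<in>carrier A. 0)"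
    using functional_dual[of F]
    by (intro extensional_carrier_eqI) (auto simp: dual_space_def coset_carrier functional_coset)
qed

text \<open>This is \<open>pairing_mult\<close> read in \<open>A\<close>: right multiplication of
  the argument by \<open>restr F\<close> is the left action on the functional of \<open>G\<close>,
  and left multiplication by \<open>restr G\<close> is the right action on that of
  \<open>F\<close>.\<close>

lemma functional_mult:
  assumes "F \<in> carrier KQs" "G \<in> carrier KQs"
  shows "functional (F \<otimes>\<^bsub>KQs\<^esub> G) =
    dual_add A (dual_act A (coset (restr F)) (functional G) \<one>\<^bsub>A\<^esub>)
               (dual_act A \<one>\<^bsub>A\<^esub> (functional F) (coset (restr G)))"
proof (rule extensional_carrier_eqI)
  show "functional (F \<otimes>\<^bsub>KQs\<^esub> G) \<in> extensional (carrier A)"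
    using functional_dual by (simp add: dual_space_def)
next
  fix x assume x: "x \<in> carrier KQ"
  then show "functional (F \<otimes>\<^bsub>KQs\<^esub> G) (coset x) =
      dual_add A (dual_act A (coset (restr F)) (functional G) \<one>\<^bsub>A\<^esub>)
               (dual_act A \<one>\<^bsub>A\<^esub> (functional F) (coset (restr G))) (coset x)"
    using assms
    by (simp add: functional_coset coset_carrier dual_add_def dual_act_def A_simps(2) A_mult
        restr_carrier pairing_mult)
qed (simp add: dual_add_def)

lemma functional_one: "functional \<one>\<^bsub>KQs\<^esub> = (\<lambda>X\<in>carrier A. 0)"
  unfolding functional_eq_zero_iff
  by (auto simp: pairing_def incl_carrier trace_incl)

lemma to_trivial_extension_hom:
  "to_trivial_extension \<in> ring_hom KQs (trivial_extension A)"
proof (rule ring_hom_memI)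
  fix F assume "F \<in> carrier KQs"
  then show "to_trivial_extension F \<in> carrier (trivial_extension A)"
    by (simp add: to_trivial_extension_def trivial_extension_def functional_dual coset_carrier restr_carrier)
next
  fix F G assume "F \<in> carrier KQs" "G \<in> carrier KQs"
  then show "to_trivial_extension (F \<otimes>\<^bsub>KQs\<^esub> G) =
      to_trivial_extension F \<otimes>\<^bsub>trivial_extension A\<^esub> to_trivial_extension G"
    "to_trivial_extension (F \<oplus>\<^bsub>KQs\<^esub> G) =
      to_trivial_extension F \<oplus>\<^bsub>trivial_extension A\<^esub> to_trivial_extension G"
    by (simp_all add: to_trivial_extension_def trivial_extension_def functional_mult functional_add
        restr_mult restr_add A_mult A_add restr_carrier)
next
  show "to_trivial_extension \<one>\<^bsub>KQs\<^esub> = \<one>\<^bsub>trivial_extension A\<^esub>"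
    by (simp add: to_trivial_extension_def trivial_extension_def functional_one restr_one A_simps(2))
qed

lemma to_trivial_extension_smult:
  assumes "F \<in> carrier KQs"
  shows "to_trivial_extension (c \<odot>\<^bsub>KQs\<^esub> F) = c \<odot>\<^bsub>trivial_extension A\<^esub> to_trivial_extension F"
  using assms
  by (simp add: to_trivial_extension_def trivial_extension_def functional_smult restr_smult A_smult restr_carrier)

lemma dual_space_coset:
  assumes f: "f \<in> dual_space A"
  shows "x \<in> carrier KQ \<Longrightarrow> y \<in> carrier KQ \<Longrightarrow> f (coset (x \<oplus>\<^bsub>KQ\<^esub> y)) = f (coset x) + f (coset y)"
    and "x \<in> carrier KQ \<Longrightarrow> f (coset (c \<odot>\<^bsub>KQ\<^esub> x)) = c * f (coset x)"
    and "x \<in> I \<Longrightarrow> f (coset x) = 0"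
proof -
  show "f (coset (x \<oplus>\<^bsub>KQ\<^esub> y)) = f (coset x) + f (coset y)"
    if "x \<in> carrier KQ" "y \<in> carrier KQ" for x y
    using f that by (simp add: dual_space_def coset_carrier flip: A_add)
  show smult: "f (coset (c \<odot>\<^bsub>KQ\<^esub> x)) = c * f (coset x)" if "x \<in> carrier KQ" for c x
    using f that by (simp add: dual_space_def coset_carrier flip: A_smult)
  show "f (coset x) = 0" if "x \<in> I"
  proof -
    have "coset x = coset \<zero>\<^bsub>KQ\<^esub>"
      using that I.a_rcos_const I.zero_closed by metis
    then show ?thesis
      using smult[OF KQ.zero_closed, of 0] by (simp add: path_algebra_simps(3,5))
  qed
qed

text \<open>The cosets of nonzero paths span \<open>A\<close>, because every other path has the zero
  coset.\<close>

lemma dual_space_eqI: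
  assumes f: "f \<in> dual_space A" and g: "g \<in> dual_space A"
    and eq: "\<And>p. p \<in> nonzero_paths \<Longrightarrow> f (coset (of_path p)) = g (coset (of_path p))"
  shows "f = g"
proof (rule extensional_carrier_eqI)
  show "f \<in> extensional (carrier A)" "g \<in> extensional (carrier A)"
    using f g by (auto simp: dual_space_def)
next
  fix x assume "x \<in> carrier KQ"
  then show "f (coset x) = g (coset x)"
  proof (induction rule: path_algebra_induct)
    case zero
    show ?case
      using dual_space_coset(3)[OF f] dual_space_coset(3)[OF g] by simp
  next
    case (add x y)
    then show ?case
      using dual_space_coset(1)[OF f] dual_space_coset(1)[OF g] by simp
  next
    case (path c p)
    have "f (coset (of_path p)) = g (coset (of_path p))"
      using path eq dual_space_coset(3)[OF f] dual_space_coset(3)[OF g]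
      by (cases "p \<in> nonzero_paths") (auto simp: nonzero_paths_def)
    then show ?case
      using path dual_space_coset(2)[OF f] dual_space_coset(2)[OF g] by (simp add: of_path_carrier)
  qed
qed

text \<open>The complement \<open>w\<close> holds the new arrow and is therefore nonempty. Once
  \<open>w\<close> is rotated to the front, its first arrow determines the cycle and with it
  \<open>p\<close>.\<close>

lemma complement_unique:
  assumes "(u, map Inl p @ w) \<in> \<S>" "(u', map Inl p' @ w) \<in> \<S>" "path_end Q (u, p) = path_end Q (u', p')"
  shows "u = u' \<and> p = p'"
proof -
  have *: "(path_end Q (u, p), w @ map Inl p) \<in> \<S>" if "(u, map Inl p @ w) \<in> \<S>" for u p
    using cycle_rotate[OF that] by simp
  have "w \<noteq> []"
    using old_prefix_of_cycle(2)[OF assms(1)] by auto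
  then have "(path_end Q (u, p), w @ map Inl p) = (path_end Q (u', p'), w @ map Inl p')"
    using *[OF assms(1)] *[OF assms(2)] by (intro cycle_unique) auto
  then have "p = p'"
    by (simp add: inj_map_eq_map)
  moreover have "path_end Qs (path_end Qs (u, map Inl p), w) = u" "path_end Qs (path_end Qs (u', map Inl p'), w) = u'"
    using cycle_closed[OF assms(1)] cycle_closed[OF assms(2)] by (simp_all add: path_end_append)
  ultimately show ?thesis
    using assms(3) by (metis path_end_map_Inl)
qed

lemma to_trivial_extension_surj:
  "to_trivial_extension ` carrier KQs = carrier (trivial_extension A)"
proof
  show "to_trivial_extension ` carrier KQs \<subseteq> carrier (trivial_extension A)"
    using to_trivial_extension_hom by (auto simp: ring_hom_def)
next
  show "carrier (trivial_extension A) \<subseteq> to_trivial_extension ` carrier KQs"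
  proof
    fix z assume "z \<in> carrier (trivial_extension A)"
    then obtain x g where z: "z = (coset x, g)" and x: "x \<in> carrier KQ" and g: "g \<in> dual_space A"
      by (auto simp: trivial_extension_def A_simps)
    \<comment> \<open>Each basis path of \<open>A\<close> gets a chosen complement
      \<open>c p\<close>; these complements play the role of the dual basis.\<close>
    have "\<forall>p\<in>nonzero_paths. \<exists>w. (fst p, map Inl (snd p) @ w) \<in> \<S>"
      using cycle_extends_nonzero_path by blast
    then obtain c where "\<forall>p\<in>nonzero_paths. (fst p, map Inl (snd p) @ c p) \<in> \<S>"
      by (rule bchoice [THEN exE])
    then have c: "(fst p, map Inl (snd p) @ c p) \<in> \<S>" if "p \<in> nonzero_paths" for p
      using that by blast
    \<comment> \<open>\<open>F'\<close> puts the prescribed value at \<open>p\<close> on the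
      complement of \<open>p\<close>. By \<open>complement_unique\<close> different \<open>p\<close>
      do not interfere.\<close>
    define F' where "F' = (\<lambda>q. \<Sum>p\<in>nonzero_paths. if q = (path_end Q p, c p) then g (coset (of_path p)) else 0)"
    define F where "F = incl x \<oplus>\<^bsub>KQs\<^esub> F'"
    have supp: "q \<in> (\<lambda>p. (path_end Q p, c p)) ` nonzero_paths" if "F' q \<noteq> 0" for q
    proof (rule ccontr)
      assume "\<not> ?thesis"
      then have "\<forall>p\<in>nonzero_paths. q \<noteq> (path_end Q p, c p)"
        by blast
      then have "F' q = 0"
        by (simp add: F'_def)
      with that show False ..
    qed
    have cpaths: "(path_end Q p, c p) \<in> paths Qs" if "p \<in> nonzero_paths" for p
      using cycle_in_paths[OF c[OF that]] by (simp add: star.paths_append)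
    have "{q. F' q \<noteq> 0} \<subseteq> (\<lambda>p. (path_end Q p, c p)) ` nonzero_paths"
      using supp by blast
    then have "finite {q. F' q \<noteq> 0}"
      by (rule finite_subset) (simp add: finite_nonzero_paths)
    moreover have "{q. F' q \<noteq> 0} \<subseteq> paths Qs"
      using supp cpaths by blast
    ultimately have F': "F' \<in> carrier KQs"
      by (simp add: path_algebra_simps(1))
    then have F: "F \<in> carrier KQs"
      unfolding F_def by (intro KQs.a_closed incl_carrier x)
    \<comment> \<open>Every complement contains a new arrow, so \<open>F'\<close> does not disturb
      the first component; conversely \<open>incl x\<close> pairs to zero and does not disturb the
      second.\<close>
    have new: "F' (u, map Inl p) = 0" for u p
    proof (rule ccontr)
      assume "F' (u, map Inl p) \<noteq> 0"
      then obtain b where "b \<in> nonzero_paths" "map Inl p = c b"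
        using supp by blast
      with c[of b] old_prefix_of_cycle(2)[of "fst b" "snd b" "c b"] show False
        by (metis all_isl_iff)
    qed
    have "restr F = x"
      by (auto simp: F_def restr_add path_algebra_simps(4) restr_apply new)
    moreover have "functional F = g"
    proof (rule dual_space_eqI[OF functional_dual g])
      fix p assume p: "p \<in> nonzero_paths"
      \<comment> \<open>For trivial \<open>p\<close> this set may hold several complements, but only
        the chosen one lies in the support of \<open>F'\<close>.\<close>
      let ?W = "{w. (fst p, map Inl (snd p) @ w) \<in> \<S>}"
      have "finite ((\<lambda>w. (fst p, map Inl (snd p) @ w)) -` \<S>)"
        by (rule finite_vimageI[OF finite_cycles]) (simp add: inj_on_def)
      then have fin: "finite ?W"
        by (simp add: vimage_def)
      have "F' (path_end Q p, w) = (if w = c p then g (coset (of_path p)) else 0)" if "w \<in> ?W" for w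
      proof -
        have unique: "p' = p" if "p' \<in> nonzero_paths" "(path_end Q p, w) = (path_end Q p', c p')" for p'
          using complement_unique[of "fst p" "snd p" w "fst p'" "snd p'"] c[OF that(1)] that \<open>w \<in> ?W\<close>
          by (simp add: prod_eq_iff)
        have "(if (path_end Q p, w) = (path_end Q p', c p') then g (coset (of_path p')) else 0) =
            (if p' = p then (if w = c p then g (coset (of_path p)) else 0) else 0)"
          if "p' \<in> nonzero_paths" for p'
        proof (cases "(path_end Q p, w) = (path_end Q p', c p')")
          case True
          with unique[OF that] show ?thesis
            by simp
        next
          case False
          then show ?thesis
            by auto
        qed
        then have "F' (path_end Q p, w) =
            (\<Sum>p'\<in>nonzero_paths. if p' = p then (if w = c p then g (coset (of_path p)) else 0) else 0)"
          unfolding F'_def by (intro sum.cong refl)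
        then show ?thesis
          using p finite_nonzero_paths by simp
      qed
      then have "(\<Sum>w\<in>?W. F' (path_end Q p, w)) = (\<Sum>w\<in>?W. if w = c p then g (coset (of_path p)) else 0)"
        by (intro sum.cong) auto
      also have "\<dots> = g (coset (of_path p))"
        using c[OF p] fin by simp
      finally have "pairing (of_path p) F' = g (coset (of_path p))"
        by (simp add: pairing_of_path_left)
      then have "pairing (of_path p) F = g (coset (of_path p))"
        by (simp add: F_def pairing_add_right pairing_incl)
      then show "functional F (coset (of_path p)) = g (coset (of_path p))"
        using p by (simp add: functional_coset of_path_carrier nonzero_paths_in_paths)
    qed
    ultimately show "z \<in> to_trivial_extension ` carrier KQs"
      using F z by (auto simp: to_trivial_extension_def)
  qed
qed

lemma to_trivial_extension_eq_zero_iff: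
  assumes "F \<in> carrier KQs"
  shows "to_trivial_extension F = \<zero>\<^bsub>trivial_extension A\<^esub> \<longleftrightarrow>
    restr F \<in> I \<and> (\<forall>x\<in>carrier KQ. pairing x F = 0)"
proof -
  have "coset (restr F) = I \<longleftrightarrow> restr F \<in> I"
    using I.a_rcos_const I.rcos_const_imp_mem restr_carrier[OF assms] by blast
  then show ?thesis
    by (simp add: to_trivial_extension_def trivial_extension_def functional_eq_zero_iff A_simps(3))
qed

lemma mem_kernel_iff:
  "F \<in> a_kernel KQs (trivial_extension A) to_trivial_extension \<longleftrightarrow>
    F \<in> carrier KQs \<and> restr F \<in> I \<and> (\<forall>x\<in>carrier KQ. pairing x F = 0)"
  unfolding a_kernel_def' using to_trivial_extension_eq_zero_iff by blast

text \<open>The ring axioms are not verified on pairs: they pass from \<open>KQs\<close> to its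
  image under the multiplicative and additive surjection.\<close>

lemma trivial_extension_ring: "ring (trivial_extension A)"
proof -
  \<comment> \<open>Preservation of zero is not part of \<open>ring_hom\<close>, so the zero of the
    image has to be identified.\<close>
  have "to_trivial_extension \<zero>\<^bsub>KQs\<^esub> = \<zero>\<^bsub>trivial_extension A\<^esub>"
  proof -
    have "restr \<zero>\<^bsub>KQs\<^esub> = \<zero>\<^bsub>KQ\<^esub>"
      by (auto simp: restr_def path_algebra_simps(3))
    moreover have "pairing x \<zero>\<^bsub>KQs\<^esub> = 0" for x
      using pairing_smult_right[of x 0 "\<zero>\<^bsub>KQs\<^esub>"] by (simp add: path_algebra_simps(3,5))
    ultimately show ?thesis
      by (subst to_trivial_extension_eq_zero_iff) auto
  qed
  then show ?thesis
    using KQs.ring_hom_imp_img_ring[OF to_trivial_extension_hom] by (simp add: to_trivial_extension_surj)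
qed

sublocale hom: ring_hom_ring KQs "trivial_extension A" to_trivial_extension
  by (intro ring_hom_ringI2 KQs.ring_axioms trivial_extension_ring to_trivial_extension_hom)

section \<open>The kernel is the ideal of the relations\<close>

abbreviation star_relations :: "(('v, 'a + ('v, 'a) qpath) qpath \<Rightarrow> 'k) set" where
  "star_relations \<equiv> type1_relations Q I \<union> type2_relations Q I \<union> type3_relations Q I"

lemma type2_relation:
  assumes "C \<in> \<S>"
  shows "of_path C \<otimes>\<^bsub>KQs\<^esub> of_arrow Qs (hd (snd C)) =
    (of_path (fst C, snd C @ [hd (snd C)]) :: _ \<Rightarrow> 'k)"
proof -
  have "tail Qs (hd (snd C)) = fst C"
    using cycle_in_paths[OF assms] cycle_nonempty[OF assms]
    by (cases C; cases "snd C") (auto simp del: star_quiver_simps)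
  then show ?thesis
    using cycle_closed[OF assms] by (simp add: of_arrow_def of_path_mult)
qed

lemma of_arrow_carrier: "a \<in> arcs Qs \<Longrightarrow> of_arrow Qs a \<in> carrier KQs"
  unfolding of_arrow_def using star.head_in_verts[of a]
  by (intro star.of_path_carrier) (simp del: star_quiver_simps)

lemma cycle_hd_arc:
  assumes "C \<in> \<S>"
  shows "hd (snd C) \<in> arcs Qs"
proof -
  have "(fst C, snd C) \<in> paths Qs"
    using cycle_in_paths[OF assms] by simp
  then show ?thesis
    using star.paths_arcs hd_in_set[OF cycle_nonempty[OF assms]] by blast
qed

lemma star_relations_carrier: "star_relations \<subseteq> carrier KQs"
  unfolding type1_relations_def type2_relations_def type3_relations_def
  by (auto simp del: star_quiver_simps
      intro!: KQs.minus_closed KQs.m_closed star.of_path_carrier of_arrow_carrier cycle_in_paths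
      cycle_hd_arc[of "(u, w)" for u w, unfolded snd_conv])

lemma ideal_star_ideal: "ideal (star_ideal Q I) KQs"
  unfolding star_ideal_def by (rule KQs.genideal_ideal[OF star_relations_carrier])

lemma star_relations_subset: "star_relations \<subseteq> star_ideal Q I"
  unfolding star_ideal_def by (rule KQs.genideal_self[OF star_relations_carrier])

lemma restr_of_path_new:
  assumes "\<not> isl a" "a \<in> set w"
  shows "restr (of_path (u, w)) = (\<lambda>p. 0)"
  using assms by (intro ext) (auto simp: restr_def of_path_def split: prod.split)

text \<open>If no cycle ends with \<open>w\<close>, no left factor can complete \<open>w\<close> to
  a cycle, so every pairing vanishes.\<close>

lemma of_path_in_kernel:
  assumes "(u, w) \<in> paths Qs" "restr (of_path (u, w)) \<in> I" "\<And>C. C \<in> \<S> \<Longrightarrow> \<not> suffix w (snd C)"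
  shows "of_path (u, w) \<in> a_kernel KQs (trivial_extension A) to_trivial_extension"
  unfolding mem_kernel_iff
  using assms pairing_of_path_eq_0[of "(u, w)"] by (simp add: star.of_path_carrier)

lemma cycle_has_new_arrow: "C \<in> \<S> \<Longrightarrow> \<exists>a\<in>set (snd C). \<not> isl a"
  using old_prefix_of_cycle(2)[of "fst C" "[]" "snd C"] by simp

text \<open>Two cycles at one vertex pair equally with everything, which settles Type 1. A path of
  Type 2 is too long to end a cycle, and a Type 3 pair occurs in no cycle.\<close>

lemma star_relations_in_kernel:
  "star_relations \<subseteq> a_kernel KQs (trivial_extension A) to_trivial_extension"
  (is "_ \<subseteq> ?K")
proof (intro Un_least subsetI)
  have zero: "(\<lambda>p. 0) \<in> I" "(\<lambda>p. 0) \<in> ?K"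
    using I.zero_closed additive_subgroup.zero_closed[OF hom.additive_subgroup_a_kernel]
    by (simp_all add: path_algebra_simps(3))
  {
    fix F assume "F \<in> type1_relations Q I"
    then obtain C C' where C: "C \<in> \<S>" "C' \<in> \<S>" "fst C = fst C'"
      and F: "F = of_path C \<ominus>\<^bsub>KQs\<^esub> of_path C'"
      by (auto simp: type1_relations_def)
    have F_eq: "F = of_path C \<oplus>\<^bsub>KQs\<^esub> (- 1) \<odot>\<^bsub>KQs\<^esub> of_path C'"
      unfolding F using C
      by (subst star.minus_path_algebra) (auto simp: star.of_path_carrier cycle_in_paths path_algebra_simps(4,5))
    have "restr (of_path D) = (\<lambda>p. 0)" if "D \<in> \<S>" for D
      using cycle_has_new_arrow[OF that] restr_of_path_new[of _ "snd D" "fst D"] by auto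
    then have "restr F = (\<lambda>p. 0)"
      using C unfolding F_eq restr_add restr_smult by (simp add: path_algebra_simps(4,5))
    then have "restr F \<in> I"
      using zero by simp
    moreover have "pairing x F = 0" for x
      using C by (simp add: F_eq pairing_add_right pairing_smult_right pairing_of_cycle)
    moreover have "F \<in> carrier KQs"
      using star_relations_carrier \<open>F \<in> type1_relations Q I\<close> by blast
    ultimately show "F \<in> ?K"
      unfolding mem_kernel_iff by blast
  next
    fix F assume "F \<in> type2_relations Q I"
    then obtain C where C: "C \<in> \<S>" and "F = of_path C \<otimes>\<^bsub>KQs\<^esub> of_arrow Qs (hd (snd C))"
      by (auto simp: type2_relations_def)
    then have F: "F = of_path (fst C, snd C @ [hd (snd C)])"
      by (simp add: type2_relation)
    have "tail Qs (hd (snd C)) = fst C"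
      using cycle_in_paths[OF C] cycle_nonempty[OF C]
      by (cases C; cases "snd C") (auto simp del: star_quiver_simps)
    then have "(fst C, snd C @ [hd (snd C)]) \<in> paths Qs"
      using cycle_in_paths[OF C] cycle_closed[OF C] cycle_hd_arc[OF C] star.head_in_verts[OF cycle_hd_arc[OF C]]
      by (simp add: star.paths_append del: star_quiver_simps)
    moreover have "restr (of_path (fst C, snd C @ [hd (snd C)])) \<in> I"
      using cycle_has_new_arrow[OF C] restr_of_path_new[of _ "snd C @ [hd (snd C)]" "fst C"] zero by auto
    moreover have "\<not> suffix (snd C @ [hd (snd C)]) (snd D)" if D: "D \<in> \<S>" for D
    proof
      assume "suffix (snd C @ [hd (snd C)]) (snd D)"
      then obtain z where "snd D = z @ snd C @ [hd (snd C)]"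
        by (auto simp: suffix_def)
      then have "(fst D, z @ snd C @ [hd (snd C)]) \<in> \<S>"
        using D by (metis prod.collapse)
      \<comment> \<open>Rotated, the cycle \<open>D\<close> begins with the first arrow of
        \<open>C\<close>, hence equals \<open>C\<close>, although it has more arrows.\<close>
      from cycle_rotate[OF this] have "(path_end Qs (fst D, z), snd C @ hd (snd C) # z) \<in> \<S>"
        by simp
      from cycle_unique[OF this C] show False
        using cycle_nonempty[OF C] by (cases C) auto
    qed
    ultimately show "F \<in> ?K"
      unfolding F by (rule of_path_in_kernel)
  next
    fix F assume "F \<in> type3_relations Q I"
    then obtain a b where ab: "a \<in> arcs Qs" "b \<in> arcs Qs" "\<not> cycle_succ a b"
      and F: "F = of_arrow Qs a \<otimes>\<^bsub>KQs\<^esub> of_arrow Qs b"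
      unfolding type3_relations_def cycle_succ_def by blast
    show "F \<in> ?K"
    proof (cases "head Qs a = tail Qs b")
      case True
      then have path: "(tail Qs a, [a, b]) \<in> paths Qs"
        using ab star.head_in_verts[OF ab(2)] by (simp del: star_quiver_simps)
      have "restr (of_path (tail Qs a, [a, b])) \<in> I"
      proof (cases "isl a \<and> isl b")
        case True
        then obtain a' b' where a'b': "a = Inl a'" "b = Inl b'"
          by (auto simp: isl_def)
        \<comment> \<open>A nonzero product of two old arrows would extend to a cycle, in which the
          pair is consecutive.\<close>
        have "(tail Q a', [a', b']) \<notin> nonzero_paths"
        proof
          assume "(tail Q a', [a', b']) \<in> nonzero_paths"
          then obtain w where "(fst (tail Q a', [a', b']), map Inl (snd (tail Q a', [a', b'])) @ w) \<in> \<S>"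
            by (rule cycle_extends_nonzero_path)
          then have "(tail Q a', [a, b] @ w) \<in> \<S>"
            by (simp add: a'b')
          then have "cycle_succ a b"
            unfolding cycle_succ_def by (intro bexI[of _ "(tail Q a', [a, b] @ w)"]) auto
          with ab(3) show False ..
        qed
        moreover have "(tail Q a', [a', b']) \<in> paths Q"
          using path paths_map_Inl[of "tail Q a'" "[a', b']"] a'b' by simp
        moreover have "restr (of_path (tail Qs a, [a, b])) = of_path (tail Q a', [a', b'])"
          using incl_of_path[of "tail Q a'" "[a', b']"] restr_incl[of "of_path (tail Q a', [a', b'])"] a'b' by simp
        ultimately show ?thesis
          by (simp add: nonzero_paths_def)
      next
        case False
        then show ?thesis
          using restr_of_path_new[of a "[a, b]" "tail Qs a"] restr_of_path_new[of b "[a, b]" "tail Qs a"] zero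
          by (auto simp del: star_quiver_simps)
      qed
      moreover have "\<not> suffix [a, b] (snd C)" if "C \<in> \<S>" for C
        using ab(3) that unfolding cycle_succ_def by blast
      ultimately have "of_path (tail Qs a, [a, b]) \<in> ?K"
        by (intro of_path_in_kernel path)
      then show ?thesis
        using True by (simp add: F of_arrow_def of_path_mult del: star_quiver_simps)
    next
      case False
      then show ?thesis
        using zero by (simp add: F of_arrow_def of_path_mult del: star_quiver_simps)
    qed
  }
qed

text \<open>By \<open>star_path_cases\<close> a path contains a Type 3 or Type 2 relation, or is
  trivial or an initial segment of a cycle. In the last two situations the kernel condition forces
  the coefficient of \<open>F\<close> to vanish, against \<open>F q \<noteq> 0\<close>. Full cycles
  are excluded, since the kernel controls only sums of their coefficients.\<close>

lemma star_path_in_ideal: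
  assumes q: "q \<in> paths Qs" "q \<notin> \<S>"
    and F: "F \<in> a_kernel KQs (trivial_extension A) to_trivial_extension" "F q \<noteq> 0"
  shows "of_path q \<in> star_ideal Q I"
proof -
  interpret star_ideal: ideal "star_ideal Q I" KQs
    by (rule ideal_star_ideal)
  have restrF: "restr F p = 0" if "p \<in> nonzero_paths" for p
    using F(1) that unfolding mem_kernel_iff mem_I_iff by blast
  obtain u w where uw: "q = (u, w)"
    by (cases q)
  show ?thesis
  proof (cases w)
    case Nil
    then have "(u, []) \<in> nonzero_paths"
      using q uw by (simp add: nonzero_paths_iff)
    with restrF[OF this] F(2) uw Nil show ?thesis
      by (simp add: restr_apply)
  next
    case (Cons a s)
    then have as: "(u, a # s) \<in> paths Qs"
      using q uw by simp
    then show ?thesis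
    proof (cases rule: star_path_cases)
      case (zero x b c y)
      have parts: "(u, x) \<in> paths Qs" "b \<in> arcs Qs" "c \<in> arcs Qs" "path_end Qs (u, x) = tail Qs b"
        "head Qs b = tail Qs c" "(head Qs c, y) \<in> paths Qs"
        using as unfolding zero(1) by (auto simp: star.paths_append simp del: star_quiver_simps)
      have "of_arrow Qs b \<otimes>\<^bsub>KQs\<^esub> of_arrow Qs c \<in> type3_relations Q I"
        using parts zero(2) unfolding type3_relations_def cycle_succ_def by blast
      then have "of_arrow Qs b \<otimes>\<^bsub>KQs\<^esub> of_arrow Qs c \<in> star_ideal Q I"
        using star_relations_subset by blast
      then have "of_path (u, x) \<otimes>\<^bsub>KQs\<^esub> (of_arrow Qs b \<otimes>\<^bsub>KQs\<^esub> of_arrow Qs c) \<in> star_ideal Q I"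
        by (rule star_ideal.I_l_closed) (intro star.of_path_carrier parts)
      then have "of_path (u, x) \<otimes>\<^bsub>KQs\<^esub> (of_arrow Qs b \<otimes>\<^bsub>KQs\<^esub> of_arrow Qs c) \<otimes>\<^bsub>KQs\<^esub> of_path (head Qs c, y)
          \<in> star_ideal Q I"
        by (rule star_ideal.I_r_closed) (intro star.of_path_carrier parts)
      also have "of_path (u, x) \<otimes>\<^bsub>KQs\<^esub> (of_arrow Qs b \<otimes>\<^bsub>KQs\<^esub> of_arrow Qs c) \<otimes>\<^bsub>KQs\<^esub> of_path (head Qs c, y)
          = of_path (u, a # s)"
        using parts unfolding zero(1)
        by (simp add: of_arrow_def of_path_mult path_end_append del: star_quiver_simps)
      finally show ?thesis
        by (simp add: uw Cons)
    next
      case (sub y)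
      have False
      proof (cases "\<forall>b\<in>set (a # s). isl b")
        case True
        then have "\<exists>p. a # s = map Inl p"
          by (simp only: all_isl_iff)
        then obtain p where p: "a # s = map Inl p" ..
        with sub have "(u, map Inl p @ y) \<in> \<S>"
          by (simp flip: p)
        then have "(u, p) \<in> nonzero_paths"
          by (rule old_prefix_of_cycle)
        with restrF[OF this] F(2) p show False
          by (simp add: uw Cons restr_apply)
      next
        \<comment> \<open>The segment already holds the new arrow, so the rest of the cycle is an
          old path and can serve as first argument of the pairing.\<close>
        case False
        then have "filter (\<lambda>b. \<not> isl b) (a # s) \<noteq> []"
          by (simp only: filter_empty_conv) blast
        moreover have "length (filter (\<lambda>b. \<not> isl b) ((a # s) @ y)) = 1"
          using cycle_one_new_arrow[OF sub] by (simp only: snd_conv append_Cons)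
        ultimately have "filter (\<lambda>b. \<not> isl b) y = []"
          unfolding filter_append length_append length_greater_0_conv [symmetric] length_0_conv [symmetric]
          by linarith
        then obtain b where b: "y = map Inl b"
          by (metis all_isl_iff filter_empty_conv)
        define v where "v = path_end Qs (u, a # s)"
        have v: "(v, map Inl b @ a # s) \<in> \<S>"
          using cycle_rotate[of u "a # s" y] sub by (simp add: v_def b)
        \<comment> \<open>The segment is not the full cycle. With a nontrivial \<open>b\<close> the
          first arrow fixes the cycle, so the pairing consists of the single term
          \<open>F q\<close>.\<close>
        have "b \<noteq> []"
          using q(2) sub b by (auto simp: uw Cons)
        have "w' = a # s" if "(v, map Inl b @ w') \<in> \<S>" for w'
          using cycle_unique[OF that v] \<open>b \<noteq> []\<close> by (cases b) auto
        then have "{w'. (v, map Inl b @ w') \<in> \<S>} = {a # s}"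
          using v by blast
        moreover have "path_end Q (v, b) = u"
          using cycle_closed[OF sub] path_end_append[of Qs u "a # s" y]
          by (simp add: v_def b)
        ultimately have "pairing (of_path (v, b)) F = F (u, a # s)"
          by (simp add: pairing_of_path_left)
        moreover have "(v, b) \<in> paths Q"
          using old_prefix_of_cycle(1)[OF v] by (rule nonzero_paths_in_paths)
        then have "pairing (of_path (v, b)) F = 0"
          using F(1) of_path_carrier unfolding mem_kernel_iff by blast
        ultimately show False
          using F(2) by (simp add: uw Cons)
      qed
      then show ?thesis ..
    next
      case (long C y)
      have "of_path C \<otimes>\<^bsub>KQs\<^esub> of_arrow Qs (hd (snd C)) \<in> type2_relations Q I"
        using long(1) unfolding type2_relations_def by blast
      then have rel: "of_path C \<otimes>\<^bsub>KQs\<^esub> of_arrow Qs (hd (snd C)) \<in> star_ideal Q I"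
        using star_relations_subset by blast
      have y: "(head Qs (hd (snd C)), y) \<in> paths Qs"
        using as unfolding long(3) by (simp add: star.paths_append del: star_quiver_simps)
      have "of_path C \<otimes>\<^bsub>KQs\<^esub> of_arrow Qs (hd (snd C)) \<otimes>\<^bsub>KQs\<^esub> of_path (head Qs (hd (snd C)), y) \<in> star_ideal Q I"
        using rel by (rule star_ideal.I_r_closed) (intro star.of_path_carrier y)
      also have "of_path C \<otimes>\<^bsub>KQs\<^esub> of_arrow Qs (hd (snd C)) \<otimes>\<^bsub>KQs\<^esub> of_path (head Qs (hd (snd C)), y) =
          of_path (u, a # s)"
        unfolding type2_relation[OF long(1)] of_path_mult long(3)
        by (simp add: long(2) del: star_quiver_simps)
      finally show ?thesis
        by (simp add: uw Cons)
    qed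
  qed
qed

lemma kernel_eq_star_ideal:
  "a_kernel KQs (trivial_extension A) to_trivial_extension = star_ideal Q I" (is "?K = ?J")
proof
  show "?J \<subseteq> ?K"
    unfolding star_ideal_def
    by (rule KQs.genideal_minimal[OF hom.kernel_is_ideal star_relations_in_kernel])
next
  interpret star_ideal: ideal "star_ideal Q I" KQs
    by (rule ideal_star_ideal)
  show "?K \<subseteq> ?J"
  proof
    fix F assume F: "F \<in> ?K"
    then have carrier: "F \<in> carrier KQs"
      unfolding mem_kernel_iff by blast
    define c where "c v = (SOME C. C \<in> \<S> \<and> fst C = v)" for v
    have c: "c (fst C) \<in> \<S>" "fst (c (fst C)) = fst C" if "C \<in> \<S>" for C
      using someI[of "\<lambda>D. D \<in> \<S> \<and> fst D = fst C" C] that by (simp_all add: c_def)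
    \<comment> \<open>Pairing with the trivial path at \<open>v\<close> adds up the coefficients of
      all cycles there.\<close>
    have sum0: "(\<Sum>C\<in>\<S>. if fst C = v then F C else 0) = 0" if v: "v \<in> verts Q" for v
    proof -
      have "(\<Sum>C\<in>\<S>. if fst C = v then F C else 0) = (\<Sum>C | C \<in> \<S> \<and> fst C = v. F C)"
        by (simp add: sum.inter_filter finite_cycles)
      also have "\<dots> = (\<Sum>w | (v, w) \<in> \<S>. F (v, w))"
        by (rule sum.reindex_bij_witness[of _ "\<lambda>w. (v, w)" snd]) auto
      also have "\<dots> = pairing (of_path (v, [])) F"
        by (simp add: pairing_of_path_left)
      also have "\<dots> = 0"
      proof -
        have "of_path (v, []) \<in> carrier KQ"
          using v by (simp add: of_path_carrier)
        then show ?thesis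
          using F unfolding mem_kernel_iff by blast
      qed
      finally show ?thesis .
    qed
    \<comment> \<open>Each cycle is compared with the reference cycle at its vertex, which costs a
      multiple of a Type 1 relation.\<close>
    have in_J: "(\<lambda>q. \<Sum>C\<in>T. F C * (of_path C q - of_path (c (fst C)) q)) \<in> ?J" if "finite T" "T \<subseteq> \<S>" for T
      using that
    proof (induction T)
      case empty
      then show ?case
        using star_ideal.zero_closed by (simp add: path_algebra_simps(3))
    next
      case (insert C T)
      then have C: "C \<in> \<S>"
        by simp
      have "of_path C \<ominus>\<^bsub>KQs\<^esub> of_path (c (fst C)) \<in> type1_relations Q I"
        unfolding type1_relations_def mem_Collect_eq using C c[OF C]
        by (intro exI[of _ C] exI[of _ "c (fst C)"]) simp
      then have "(\<lambda>q. of_path C q - of_path (c (fst C)) q) \<in> ?J"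
        using star_relations_subset C c(1)[OF C]
        by (simp add: star.minus_path_algebra star.of_path_carrier cycle_in_paths subset_iff)
      then have "F C \<odot>\<^bsub>KQs\<^esub> (\<lambda>q. of_path C q - of_path (c (fst C)) q) \<in> ?J"
        by (rule star.ideal_smult_closed[OF ideal_star_ideal])
      with insert have "(F C \<odot>\<^bsub>KQs\<^esub> (\<lambda>q. of_path C q - of_path (c (fst C)) q)) \<oplus>\<^bsub>KQs\<^esub>
          (\<lambda>q. \<Sum>C\<in>T. F C * (of_path C q - of_path (c (fst C)) q)) \<in> ?J"
        by (intro star_ideal.a_closed) auto
      then show ?case
        using insert.hyps by (simp add: path_algebra_simps(4,5))
    qed
    \<comment> \<open>The reference terms cancel: at each reference cycle they collect all cycle
      coefficients of its vertex, with sum zero by \<open>sum0\<close>. What remains is the part of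
      \<open>F\<close> on cycles.\<close>
    have "(\<Sum>C\<in>\<S>. F C * (of_path C q - of_path (c (fst C)) q)) = (if q \<in> \<S> then F q else 0)" for q
    proof -
      have "(\<Sum>C\<in>\<S>. F C * of_path C q) = (\<Sum>C\<in>\<S>. if C = q then F q else 0)"
        by (intro sum.cong) (auto simp: of_path_def)
      moreover have "(\<Sum>C\<in>\<S>. F C * of_path (c (fst C)) q) = 0"
      proof (cases "q \<in> c ` fst ` \<S>")
        case True
        then obtain D where D: "D \<in> \<S>" "q = c (fst D)"
          by blast
        then have "(\<Sum>C\<in>\<S>. F C * of_path (c (fst C)) q) = (\<Sum>C\<in>\<S>. if fst C = fst D then F C else 0)"
        proof (intro sum.cong refl)
          fix C assume "C \<in> \<S>"
          then have "c (fst C) = q \<longleftrightarrow> fst C = fst D"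
            using c(2) D by metis
          then show "F C * of_path (c (fst C)) q = (if fst C = fst D then F C else 0)"
            by (auto simp: of_path_def)
        qed
        then show ?thesis
          using sum0 star.path_start_in_verts[OF cycle_in_paths[OF D(1)]] by simp
      next
        case False
        then show ?thesis
          by (intro sum.neutral) (auto simp: of_path_def)
      qed
      ultimately show ?thesis
        using finite_cycles by (simp add: right_diff_distrib sum_subtractf)
    qed
    with in_J[OF finite_cycles subset_refl] have "(\<lambda>q. if q \<in> \<S> then F q else 0) \<in> ?J"
      by simp
    moreover have "(\<lambda>q. if q \<notin> \<S> then F q else 0) \<in> ?J"
    proof (rule star.ideal_of_paths[OF ideal_star_ideal star.restrict_carrier[OF carrier]])
      fix q assume "q \<in> paths Qs" "(if q \<notin> \<S> then F q else 0) \<noteq> 0"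
      then show "of_path q \<in> ?J"
        using star_path_in_ideal[of q F] F by (auto split: if_splits)
    qed
    ultimately have "(\<lambda>q. if q \<in> \<S> then F q else 0) \<oplus>\<^bsub>KQs\<^esub> (\<lambda>q. if q \<notin> \<S> then F q else 0) \<in> ?J"
      by (rule star_ideal.a_closed)
    also have "(\<lambda>q. if q \<in> \<S> then F q else 0) \<oplus>\<^bsub>KQs\<^esub> (\<lambda>q. if q \<notin> \<S> then F q else 0) = F"
      by (auto simp: path_algebra_simps(4))
    finally show "F \<in> ?J" .
  qed
qed

text \<open>The isomorphism theorem for rings sends a coset of the kernel to the single element of
  its image. Compatibility with scalars is checked on representatives, because that theorem concerns
  rings only.\<close>

lemma star_algebra_iso: "alg_isomorphic (star_algebra Q I) (trivial_extension A)"
proof -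
  let ?h = "\<lambda>X. the_elem (to_trivial_extension ` X)"
  have "?h \<in> ring_iso (KQs Quot star_ideal Q I) (trivial_extension A)"
    using hom.FactRing_iso_set[OF to_trivial_extension_surj] by (simp add: kernel_eq_star_ideal)
  then have "?h \<in> ring_iso (star_algebra Q I) (trivial_extension A)"
    by (simp add: ring_iso_def ring_hom_def star_algebra_def quot_algebra_def)
  moreover have "?h (c \<odot>\<^bsub>star_algebra Q I\<^esub> X) = c \<odot>\<^bsub>trivial_extension A\<^esub> ?h X"
    if X: "X \<in> carrier (star_algebra Q I)" for c X
  proof -
    obtain F where F: "F \<in> carrier KQs" "X = star_ideal Q I +>\<^bsub>KQs\<^esub> F"
      using X by (auto simp: star_algebra_def star.quot_algebra_simps)
    have h: "?h (star_ideal Q I +>\<^bsub>KQs\<^esub> G) = to_trivial_extension G" if "G \<in> carrier KQs" for G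
      using hom.the_elem_simp[OF that] by (simp add: kernel_eq_star_ideal)
    show ?thesis
      using F by (simp add: star_algebra_def star.quot_algebra_smult[OF ideal_star_ideal] h
          star.smult_carrier to_trivial_extension_smult)
  qed
  ultimately show ?thesis
    unfolding alg_isomorphic_def alg_iso_def by blast
qed

end

theorem theorem4p3:
  fixes Q :: "('v, 'a) pre_digraph"
    and I :: "(('v, 'a) qpath \<Rightarrow> 'k::field) set"
  assumes "fin_digraph Q"
    and "admissible Q I"
    and "almost_gentle Q I"
    and "indecomposable_algebra (quot_algebra (path_algebra Q) I)"
  shows "alg_isomorphic (star_algebra Q I)
           (trivial_extension (quot_algebra (path_algebra Q) I))"
proof -
  interpret fin_digraph Q by fact
  interpret almost_gentle_algebra Q I
    using assms(2,3) by unfold_locales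
  show ?thesis
    by (rule star_algebra_iso)
qed

end
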